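(* Consider the facilitated exclusion process on the segment $\{1,\ldots,N\}$ with $k$ particles and parameter $p\in(1/2,1)$, $q=1-p$, and let $T^{N,k}_{\mathrm{seg}}(\epsilon)$ denote its $\epsilon$-mixing time. Let $\epsilon\in(0,1)$ and let $k=k(N)$ be a sequence of integers such that $k>N/2$ and $N-k\gg\log N$ (that is, $(\log N)/(N-k)\to 0$ as $N\to\infty$). Then $$ \lim_{N\rightarrow\infty}\frac{\log T_{\mathrm{seg}}^{N,k}(\epsilon)}{N-k}=\log\Bigl(\frac{p}{q}\Bigr). $$
   Context: Facilitated exclusion process (FEP) on the segment. For integers $N\ge 1$ and $N/2<k\le N$ let $\Omega_{N,k}=\{\xi\in\{0,1\}^{N}:\sum_{x=1}^{N}\xi(x)=k\}$; $\xi(x)=1$ means there is a particle at $x$, $\xi(x)=0$ means there is a hole at $x$. Let $p,q\ge 0$ with $p+q=1$. The FEP on the segment $[N]=\{1,\ldots,N\}$ with parameter $p$ is the continuous-time Markov chain on $\Omega_{N,k}$ with generator $$\mathcal{L}f(\xi)=\sum_{x=2}^{N-1}p\,\xi(x)\xi(x-1)(1-\xi(x+1))[f(\xi^{x,x+1})-f(\xi)]+\sum_{x=2}^{N-1}q\,\xi(x)\xi(x+1)(1-\xi(x-1))[f(\xi^{x,x-1})-f(\xi)],$$ where $\xi^{x,y}$ is obtained from $\xi$ by exchanging the values at $x$ and $y$. The ergodic component is $\mathcal{E}_{N,k}=\{\xi\in\Omega_{N,k}:\xi(x)+\xi(x+1)\ge 1\ \forall x\in\{1,\ldots,N-1\},\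 \xi(1)\xi(N)=1\}$. For $p\in(1/2,1)$, with $\lambda=q/p$, the equilibrium distribution $\mu_{N,k}$ is the probability measure supported on $\mathcal{E}_{N,k}$ given for $\xi\in\mathcal{E}_{N,k}$ by $$\mu_{N,k}(\xi)=\frac{\lambda^{-A(\xi)}}{\sum_{\xi'\in\mathcal{E}_{N,k}}\lambda^{-A(\xi')}},\qquad A(\xi)=\sum_{i=1}^{N-k}x_i,$$ where $x_1<\cdots<x_{N-k}$ are the positions of the holes of $\xi$. Let $P_t^{\xi}$ be the law at time $t$ of the FEP started from $\xi\in\Omega_{N,k}$. Set $d_{N,k}(t)=\max_{\xi\in\Omega_{N,k}}\|P_t^{\xi}-\mu_{N,k}\|_{\mathrm{TV}}$ (total variation distance) and $T^{N,k}_{\mathrm{seg}}(\epsilon)=\inf\{t\ge 0: d_{N,k}(t)\le\epsilon\}$.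
   Formalization: The equilibrium distribution is taken with weight λ^{A(ξ)} instead of the printed λ^{-A(ξ)} (A the sum of hole positions, λ=q/p): the printed weight is not stationary for the given generator, and with it the mixing time would be infinite, e.g. for k≈3N/4. *)

theory Defs
  imports Complex_Main "HOL-Library.FuncSet" "HOL-Library.Indicator_Function" "HOL-Library.Landau_Symbols"
    "HOL-Combinatorics.Transposition"
begin

type_synonym config = "nat \<Rightarrow> nat"

definition fep_configs :: "nat \<Rightarrow> nat \<Rightarrow> config set" where
  "fep_configs N k = {\<xi> \<in> {1..N} \<rightarrow>\<^sub>E {0, 1}. (\<Sum>x=1..N. \<xi> x) = k}"

definition exchange :: "config \<Rightarrow> nat \<Rightarrow> nat \<Rightarrow> config" where
  "exchange \<xi> x y = \<xi> \<circ> transpose x y"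

definition fep_generator :: "real \<Rightarrow> real \<Rightarrow> nat \<Rightarrow> (config \<Rightarrow> real) \<Rightarrow> config \<Rightarrow> real" where
  "fep_generator p q N f \<xi> =
     (\<Sum>x=2..N - 1. p * real (\<xi> x) * real (\<xi> (x - 1)) * (1 - real (\<xi> (x + 1)))
        * (f (exchange \<xi> x (x + 1)) - f \<xi>))
   + (\<Sum>x=2..N - 1. q * real (\<xi> x) * real (\<xi> (x + 1)) * (1 - real (\<xi> (x - 1)))
        * (f (exchange \<xi> x (x - 1)) - f \<xi>))"

text \<open>
  The law at time \<open>t\<close> of the chain started from \<open>\<xi>\<close>, as a mass function: the state space is finite,
  so the transition semigroup is the exponential \<open>exp (t L)\<close> of the generator \<open>L\<close>, and the mass
  at \<open>\<eta>\<close> is \<open>exp (t L)\<close> applied to the indicator of \<open>\<eta>\<close>, evaluated at \<open>\<xi>\<close>.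
\<close>

definition fep_law :: "real \<Rightarrow> real \<Rightarrow> nat \<Rightarrow> real \<Rightarrow> config \<Rightarrow> config \<Rightarrow> real" where
  "fep_law p q N t \<xi> \<eta> =
     (\<Sum>n. t ^ n / fact n * ((fep_generator p q N ^^ n) (indicator {\<eta>})) \<xi>)"

definition fep_ergodic :: "nat \<Rightarrow> nat \<Rightarrow> config set" where
  "fep_ergodic N k =
     {\<xi> \<in> fep_configs N k. (\<forall>x\<in>{1..N - 1}. \<xi> x + \<xi> (x + 1) \<ge> 1) \<and> \<xi> 1 * \<xi> N = 1}"

definition hole_area :: "nat \<Rightarrow> config \<Rightarrow> nat" where
  "hole_area N \<xi> = \<Sum> {x \<in> {1..N}. \<xi> x = 0}"

text \<open>
  Sign of the exponent: a particle jump to the right, at rate \<open>p\<close>, lowers the sum \<open>A\<close> of the hole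
  positions by one, and the reverse jump has rate \<open>q\<close>. Reversibility of the weights therefore
  requires \<open>(q/p) ^ A\<close>. The weight \<open>(q/p) ^ (-A)\<close>, as sometimes printed, is not stationary for
  \<open>fep_generator\<close>: for \<open>N = 4\<close>, \<open>k = 3\<close> the two ergodic configurations are 1101, with \<open>A = 3\<close>,
  and 1011, with \<open>A = 2\<close>; the first jumps to the second at rate \<open>p\<close> and back at rate \<open>q\<close>, so
  their equilibrium masses are \<open>q\<close> and \<open>p\<close>. (Up to normalisation, the negative exponent is right
  when \<open>A\<close> is the sum of the particle positions.)
\<close>

definition fep_equilibrium :: "real \<Rightarrow> real \<Rightarrow> nat \<Rightarrow> nat \<Rightarrow> config \<Rightarrow> real" where
  "fep_equilibrium p q N k \<xi> =
     (if \<xi> \<in> fep_ergodic N k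
      then (q / p) ^ hole_area N \<xi> / (\<Sum>\<xi>'\<in>fep_ergodic N k. (q / p) ^ hole_area N \<xi>')
      else 0)"

definition tv_dist :: "'a set \<Rightarrow> ('a \<Rightarrow> real) \<Rightarrow> ('a \<Rightarrow> real) \<Rightarrow> real" where
  "tv_dist S \<mu> \<nu> = (MAX B\<in>Pow S. \<bar>(\<Sum>x\<in>B. \<mu> x) - (\<Sum>x\<in>B. \<nu> x)\<bar>)"

definition fep_distance :: "real \<Rightarrow> real \<Rightarrow> nat \<Rightarrow> nat \<Rightarrow> real \<Rightarrow> real" where
  "fep_distance p q N k t =
     (MAX \<xi>\<in>fep_configs N k.
        tv_dist (fep_configs N k) (fep_law p q N t \<xi>) (fep_equilibrium p q N k))"

definition fep_mixing_time :: "real \<Rightarrow> real \<Rightarrow> nat \<Rightarrow> nat \<Rightarrow> real \<Rightarrow> real" where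
  "fep_mixing_time p q N k \<epsilon> = Inf {t. t \<ge> 0 \<and> fep_distance p q N k t \<le> \<epsilon>}"

end

theory Submission imports Defs begin

text \<open>
  Let \<open>m = N - k\<close> be the number of holes. The holes cut the segment into \<open>m + 1\<close> gaps, numbered
  \<open>0, \<dots>, m\<close> from the left, and a gap with at least two particles sends one of them to the next gap
  on the right at rate \<open>p\<close> and to the next gap on the left at rate \<open>q < p\<close>. A configuration is
  ergodic when no gap is empty. The mixing time grows like \<open>(p / q) ^ m\<close>, up to a polynomial factor
  in \<open>N\<close>, because from the worst configuration a particle has to cross all gaps against the drift to
  fill gap \<open>0\<close>. As \<open>ln N\<close> is negligible against \<open>m\<close>, polynomial factors do not affect the limit.

  Lower bound. For a single walk with rates \<open>p\<close> and \<open>q\<close> the function \<open>i \<mapsto> (q / p) ^ i\<close> is harmonic,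
  so the sum of \<open>(q / p) ^ i\<close> over all particles, \<open>i\<close> being the gap of the particle, grows in the mean
  only through jumps out of gap \<open>m\<close>, at rate at most \<open>(p - q) * (q / p) ^ m\<close>
  (\<open>generator_harmonic_sum\<close>). The sum is at least \<open>1\<close> on ergodic configurations and at most
  \<open>N * (q / p) ^ m\<close> when all particles sit at the right end. Started there, the process
  is ergodic at time \<open>t\<close> with probability at most \<open>(N + t) * (q / p) ^ m\<close> (\<open>distance_lower_bound\<close>).

  Upper bound, transient phase. An empty gap \<open>j\<close> is a target for all other particles. Give
  each particle in gap \<open>i\<close> (a supersolution of) the mean time that a walk needs from \<open>i\<close> to \<open>j\<close>; the
  sum decreases at rate at least \<open>1\<close>, since outside the ergodic component some gap holds two
  particles (\<open>trap_drift\<close>). Adding a large constant for each empty gap gives a potential that also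
  survives the change of target (\<open>trap_potential_drift\<close>), so the ergodic component is reached within
  time of order \<open>(p / q) ^ m\<close> times a power of \<open>N\<close> (\<open>escape_to_ergodic\<close>).

  Upper bound, ergodic phase. Inside the ergodic component every gap has one particle that stays and
  the others, its excess, move like a zero range process. Each excess particle corresponds to a pair
  of adjacent particles. Weighting pair number \<open>R\<close> in gap \<open>H\<close> by \<open>v ^ R * (v ^ (m - H) - 1)\<close> where
  \<open>v > 1\<close> and \<open>q * v\<^sup>2 \<le> p\<close> gives a function \<open>V\<close> with \<open>L V \<le> c * (1 - (v - 1) * V)\<close>
  (\<open>excess_drift\<close>), so after time polynomial in \<open>N\<close> it has bounded mean. Where \<open>V\<close> is
  bounded, a bounded number of jumps leads to the ground state, in which all excess is in gap \<open>m\<close>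
  (\<open>reach_ground\<close>). Altogether, after a time of order \<open>(p / q) ^ m\<close> times a power of \<open>N\<close>, every initial
  configuration puts mass at least of order a power of \<open>1 / N\<close> on the ground state
  (\<open>ground_minorization\<close>), and Doeblin's argument finishes (\<open>doeblin_convergence\<close>).

  All estimates are made for the discrete chain \<open>K = I + L / (2 * N)\<close>; the law at time \<open>t\<close> is the
  average of its powers over a Poisson variable of mean \<open>2 * N * t\<close> (\<open>uniformization\<close>).
\<close>

section \<open>Markov operators on a finite set\<close>

text \<open>
  Transition operators are treated as operators on functions, of which only the values on \<open>S\<close> matter.
  The same operator can then be studied on the whole state space and on an absorbing subset.
\<close>

locale markov_operator =
  fixes S :: "'a set" and K :: "('a \<Rightarrow> real) \<Rightarrow> 'a \<Rightarrow> real"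
  assumes finite_S: "finite S"
    and linear: "x \<in> S \<Longrightarrow> K (\<lambda>y. a * f y + b * g y) x = a * K f x + b * K g x"
    and positive: "(\<And>y. y \<in> S \<Longrightarrow> 0 \<le> f y) \<Longrightarrow> x \<in> S \<Longrightarrow> 0 \<le> K f x"
    and unital: "x \<in> S \<Longrightarrow> K (\<lambda>_. 1) x = 1"
begin

lemma mono:
  assumes "\<And>y. y \<in> S \<Longrightarrow> f y \<le> g y" "x \<in> S"
  shows "K f x \<le> K g x"
proof -
  have "0 \<le> K (\<lambda>y. 1 * g y + (-1) * f y) x"
    by (rule positive) (use assms in auto)
  then show ?thesis using linear[OF assms(2), of 1 g "-1" f] by simp
qed

lemma cong:
  assumes "\<And>y. y \<in> S \<Longrightarrow> f y = g y" "x \<in> S"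
  shows "K f x = K g x"
  using mono[of f g x] mono[of g f x] assms by force

lemma const: "x \<in> S \<Longrightarrow> K (\<lambda>_. c) x = c"
  using linear[of x c "\<lambda>_. 1" 0 "\<lambda>_. 1"] unital by simp

lemma affine: "x \<in> S \<Longrightarrow> K (\<lambda>y. a * f y + b) x = a * K f x + b"
  using linear[of x a f b "\<lambda>_. 1"] unital by simp

lemma power: "markov_operator S (K ^^ n)"
proof (induction n)
  case 0
  show ?case by standard (auto simp: finite_S)
next
  case (Suc n)
  interpret Kn: markov_operator S "K ^^ n" by (rule Suc)
  show ?case
  proof
    fix x a f b g assume x: "x \<in> S"
    have "K ((K ^^ n) (\<lambda>y. a * f y + b * g y)) x = K (\<lambda>y. a * (K ^^ n) f y + b * (K ^^ n) g y) x"
      by (rule cong) (auto simp: x Kn.linear)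
    then show "(K ^^ Suc n) (\<lambda>y. a * f y + b * g y) x = a * (K ^^ Suc n) f x + b * (K ^^ Suc n) g x"
      by (simp add: linear x)
  next
    fix f x assume "\<And>y. y \<in> S \<Longrightarrow> 0 \<le> (f y :: real)" and x: "x \<in> S"
    then show "0 \<le> (K ^^ Suc n) f x" by (auto intro!: positive Kn.positive)
  next
    fix x assume x: "x \<in> S"
    have "K ((K ^^ n) (\<lambda>_. 1)) x = K (\<lambda>_. 1) x" by (rule cong) (auto simp: x Kn.unital)
    then show "(K ^^ Suc n) (\<lambda>_. 1) x = 1" by (simp add: unital x)
  qed (rule finite_S)
qed

lemmas mono_power = markov_operator.mono[OF power]
lemmas linear_power = markov_operator.linear[OF power]
lemmas affine_power = markov_operator.affine[OF power]
lemmas const_power = markov_operator.const[OF power]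
lemmas positive_power = markov_operator.positive[OF power]

lemma bounds_power:
  assumes "\<And>y. y \<in> S \<Longrightarrow> lo \<le> f y" "\<And>y. y \<in> S \<Longrightarrow> f y \<le> hi" "x \<in> S"
  shows "lo \<le> (K ^^ n) f x" "(K ^^ n) f x \<le> hi"
  using mono_power[of "\<lambda>_. lo" f x n] mono_power[of f "\<lambda>_. hi" x n] assms const_power by auto

lemma sum_power:
  assumes x: "x \<in> S" and "finite B"
  shows "(K ^^ n) (\<lambda>y. \<Sum>b\<in>B. g b y) x = (\<Sum>b\<in>B. (K ^^ n) (g b) x)"
  using \<open>finite B\<close>
proof (induction B rule: finite_induct)
  case empty
  then show ?case using const_power[OF x, of n 0] by simp
next
  case (insert b B)
  have "(K ^^ n) (\<lambda>y. 1 * g b y + 1 * (\<Sum>b\<in>B. g b y)) x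
      = 1 * (K ^^ n) (g b) x + 1 * (K ^^ n) (\<lambda>y. \<Sum>b\<in>B. g b y) x"
    by (rule linear_power[OF x])
  then show ?case using insert by simp
qed

text \<open>
  For the indicator \<open>g\<close> of the complement of an absorbing set, \<open>V\<close> pays \<open>d\<close> for each step spent
  outside; as the probability of being outside decreases in time, the \<open>n\<close>-th term is at most the
  average of the first \<open>n\<close>.
\<close>

lemma excursion_bound:
  assumes V: "\<And>x. x \<in> S \<Longrightarrow> 0 \<le> V x"
    and drift: "\<And>x. x \<in> S \<Longrightarrow> K V x \<le> V x - d * g x"
    and super: "\<And>x. x \<in> S \<Longrightarrow> K g x \<le> g x"
    and "0 \<le> d" "x \<in> S"
  shows "real n * d * (K ^^ n) g x \<le> V x"
proof -
  have g: "(K ^^ n) g x \<le> g x" if "x \<in> S" for x n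
    using that
  proof (induction n arbitrary: x)
    case (Suc n)
    have "(K ^^ Suc n) g x \<le> K g x" using mono[of "(K ^^ n) g" g x] Suc by simp
    also have "\<dots> \<le> g x" using super Suc by simp
    finally show ?case .
  qed simp
  have "real n * d * (K ^^ n) g x \<le> V x - (K ^^ n) V x"
    using \<open>x \<in> S\<close>
  proof (induction n arbitrary: x)
    case (Suc n)
    have "K (\<lambda>y. (real n * d) * (K ^^ n) g y + 1 * (K ^^ n) V y) x \<le> K V x"
      by (rule mono) (use Suc in fastforce)+
    then have "real n * d * (K ^^ Suc n) g x + (K ^^ Suc n) V x \<le> K V x"
      using linear[OF Suc.prems, of "real n * d" "(K ^^ n) g" 1 "(K ^^ n) V"] by simp
    moreover have "d * (K ^^ Suc n) g x \<le> d * g x"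
      using g[of x "Suc n"] Suc.prems \<open>0 \<le> d\<close> by (intro mult_left_mono) auto
    ultimately show ?case using drift[OF Suc.prems] by (simp add: algebra_simps)
  qed simp
  moreover have "0 \<le> (K ^^ n) V x" by (rule positive_power) (use V \<open>x \<in> S\<close> in auto)
  ultimately show ?thesis by linarith
qed

lemma contracting_bound:
  assumes drift: "\<And>x. x \<in> S \<Longrightarrow> K V x \<le> (1 - r) * V x + r * B" and "r \<le> 1" "x \<in> S"
  shows "(K ^^ n) V x \<le> (1 - r) ^ n * (V x - B) + B"
  using \<open>x \<in> S\<close>
proof (induction n arbitrary: x)
  case (Suc n)
  have "(K ^^ Suc n) V x \<le> K (\<lambda>y. (1 - r) ^ n * V y + (B - (1 - r) ^ n * B)) x"
    using mono[of "(K ^^ n) V" "\<lambda>y. (1 - r) ^ n * V y + (B - (1 - r) ^ n * B)" x] Suc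
    by (simp add: algebra_simps)
  also have "\<dots> = (1 - r) ^ n * K V x + (B - (1 - r) ^ n * B)" by (rule affine[OF Suc.prems])
  also have "\<dots> \<le> (1 - r) ^ n * ((1 - r) * V x + r * B) + (B - (1 - r) ^ n * B)"
    using drift[OF Suc.prems] \<open>r \<le> 1\<close> by (intro add_right_mono mult_left_mono) auto
  also have "\<dots> = (1 - r) ^ Suc n * (V x - B) + B" by (simp add: algebra_simps)
  finally show ?case .
qed simp

lemma linear_growth_bound:
  assumes drift: "\<And>x. x \<in> S \<Longrightarrow> K V x \<le> V x + r" and "x \<in> S"
  shows "(K ^^ n) V x \<le> V x + real n * r"
  using \<open>x \<in> S\<close>
proof (induction n arbitrary: x)
  case (Suc n)
  have "(K ^^ Suc n) V x \<le> K (\<lambda>y. 1 * V y + real n * r) x"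
    using mono[of "(K ^^ n) V" "\<lambda>y. 1 * V y + real n * r" x] Suc by simp
  also have "\<dots> = K V x + real n * r" using affine[OF Suc.prems, of 1 V "real n * r"] by simp
  also have "\<dots> \<le> V x + real (Suc n) * r" using drift[OF Suc.prems] by (simp add: algebra_simps)
  finally show ?case .
qed simp

text \<open>
  Whatever the starting point, a fraction \<open>c\<close> of the mass sits at \<open>z\<close> after \<open>M\<close> steps and
  contributes the same value \<open>f z\<close>; hence the range of \<open>f\<close> shrinks by the factor \<open>1 - c\<close>.
\<close>

lemma doeblin_interval:
  assumes z: "z \<in> S" and minor: "\<And>x. x \<in> S \<Longrightarrow> c \<le> (K ^^ M) (indicator {z}) x"
    and lo: "\<And>y. y \<in> S \<Longrightarrow> lo \<le> f y" and hi: "\<And>y. y \<in> S \<Longrightarrow> f y \<le> hi"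
  shows "\<exists>lo' hi'. hi' - lo' = (1 - c) ^ j * (hi - lo) \<and>
           (\<forall>x\<in>S. lo' \<le> (K ^^ (j * M)) f x \<and> (K ^^ (j * M)) f x \<le> hi')"
proof (induction j)
  case 0
  then show ?case using lo hi by (intro exI[of _ lo] exI[of _ hi]) auto
next
  case (Suc j)
  then obtain lo' hi' where d: "hi' - lo' = (1 - c) ^ j * (hi - lo)"
    and b: "\<And>x. x \<in> S \<Longrightarrow> lo' \<le> (K ^^ (j * M)) f x \<and> (K ^^ (j * M)) f x \<le> hi'" by blast
  define g where "g = (K ^^ (j * M)) f"
  have gb: "lo' \<le> g y" "g y \<le> hi'" if "y \<in> S" for y using b[OF that] by (auto simp: g_def)
  have "lo' + c * (g z - lo') \<le> (K ^^ M) g x \<and> (K ^^ M) g x \<le> hi' - c * (hi' - g z)"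
    if x: "x \<in> S" for x
  proof
    have "(g z - lo') * (K ^^ M) (indicator {z}) x + lo' \<le> (K ^^ M) g x"
      unfolding affine_power[OF x, symmetric]
      by (rule mono_power[OF _ x]) (auto simp: gb indicator_def)
    moreover have "(g z - lo') * c \<le> (g z - lo') * (K ^^ M) (indicator {z}) x"
      using minor[OF x] gb[OF z] by (intro mult_left_mono) auto
    ultimately show "lo' + c * (g z - lo') \<le> (K ^^ M) g x" by (simp add: algebra_simps)
    have "(K ^^ M) g x \<le> (g z - hi') * (K ^^ M) (indicator {z}) x + hi'"
      unfolding affine_power[OF x, symmetric]
      by (rule mono_power[OF _ x]) (auto simp: gb indicator_def)
    moreover have "(g z - hi') * (K ^^ M) (indicator {z}) x \<le> (g z - hi') * c"
      using minor[OF x] gb[OF z] by (intro mult_left_mono_neg) auto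
    ultimately show "(K ^^ M) g x \<le> hi' - c * (hi' - g z)" by (simp add: algebra_simps)
  qed
  moreover have "(K ^^ (Suc j * M)) f = (K ^^ M) g" by (simp add: g_def funpow_add)
  moreover have "(hi' - c * (hi' - g z)) - (lo' + c * (g z - lo')) = (1 - c) ^ Suc j * (hi - lo)"
  proof -
    have "(hi' - c * (hi' - g z)) - (lo' + c * (g z - lo')) = (1 - c) * (hi' - lo')"
      by (simp add: algebra_simps)
    then show ?thesis by (simp add: d)
  qed
  ultimately show ?case
    by (intro exI[of _ "lo' + c * (g z - lo')"] exI[of _ "hi' - c * (hi' - g z)"]) simp
qed

text \<open>
  A stationary average of \<open>f\<close> equals that of \<open>K ^^ n\<close> applied to \<open>f\<close>, so it lies in the interval
  that contains the values of the latter.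
\<close>

lemma doeblin_convergence:
  assumes z: "z \<in> S" and minor: "\<And>x. x \<in> S \<Longrightarrow> c \<le> (K ^^ M) (indicator {z}) x"
    and lo: "\<And>y. y \<in> S \<Longrightarrow> 0 \<le> f y" and hi: "\<And>y. y \<in> S \<Longrightarrow> f y \<le> 1"
    and \<mu>: "\<And>y. y \<in> S \<Longrightarrow> 0 \<le> \<mu> y" "(\<Sum>y\<in>S. \<mu> y) = 1"
    and stat: "\<And>f. (\<Sum>y\<in>S. \<mu> y * K f y) = (\<Sum>y\<in>S. \<mu> y * f y)"
    and n: "j * M \<le> n" and x: "x \<in> S"
  shows "\<bar>(K ^^ n) f x - (\<Sum>y\<in>S. \<mu> y * f y)\<bar> \<le> (1 - c) ^ j"
proof -
  obtain lo' hi' where d: "hi' - lo' = (1 - c) ^ j"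
    and b: "\<And>x. x \<in> S \<Longrightarrow> lo' \<le> (K ^^ (j * M)) f x \<and> (K ^^ (j * M)) f x \<le> hi'"
    using doeblin_interval[OF z minor, of 0 f 1 j] lo hi by auto
  have "(K ^^ n) f = (K ^^ (n - j * M)) ((K ^^ (j * M)) f)"
    using n by (simp flip: funpow_add comp_apply[of "K ^^ _" "K ^^ _"])
  then have bn: "lo' \<le> (K ^^ n) f x \<and> (K ^^ n) f x \<le> hi'" if "x \<in> S" for x
    using bounds_power[of lo' "(K ^^ (j * M)) f" hi' x "n - j * M"] b that by auto
  have "(\<Sum>y\<in>S. \<mu> y * (K ^^ n) f y) = (\<Sum>y\<in>S. \<mu> y * f y)"
    by (induction n) (auto simp: stat)
  moreover have "lo' * 1 \<le> (\<Sum>y\<in>S. \<mu> y * (K ^^ n) f y)" "(\<Sum>y\<in>S. \<mu> y * (K ^^ n) f y) \<le> hi' * 1"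
    unfolding \<mu>(2)[symmetric] sum_distrib_left
    by (intro sum_mono; use bn \<mu>(1) in \<open>metis mult.commute mult_left_mono\<close>)+
  ultimately show ?thesis using bn[OF x] d by auto
qed

text \<open>
  This is the binomial expansion of \<open>(\<Lambda> * (K - I)) ^ n\<close>.
\<close>

lemma uniformization_binomial:
  assumes L: "\<And>f x. x \<in> S \<Longrightarrow> L f x = \<Lambda> * (K f x - f x)" and x: "x \<in> S"
  shows "(L ^^ n) f x = (\<Sum>i\<le>n. real (n choose i) * \<Lambda> ^ n * (-1) ^ (n - i) * (K ^^ i) f x)"
  using x
proof (induction n arbitrary: x)
  case (Suc n)
  have "K ((L ^^ n) f) x = K (\<lambda>y. \<Sum>i\<le>n. (real (n choose i) * \<Lambda> ^ n * (-1) ^ (n - i)) * (K ^^ i) f y) x"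
    by (rule cong) (use Suc in auto)
  also have "\<dots> = (\<Sum>i\<le>n. K (\<lambda>y. (real (n choose i) * \<Lambda> ^ n * (-1) ^ (n - i)) * (K ^^ i) f y) x)"
    using sum_power[OF Suc.prems, of "{..n}" 1] by simp
  also have "\<dots> = (\<Sum>i\<le>n. (real (n choose i) * \<Lambda> ^ n * (-1) ^ (n - i)) * (K ^^ Suc i) f x)"
    by (rule sum.cong[OF refl])
       (use affine[OF Suc.prems, of _ _ 0] in simp)
  finally have KL: "K ((L ^^ n) f) x = (\<Sum>i\<le>n. (real (n choose i) * \<Lambda> ^ n * (-1) ^ (n - i)) * (K ^^ Suc i) f x)" .
  have "(\<Sum>i\<le>Suc n. real (Suc n choose i) * \<Lambda> ^ Suc n * (-1) ^ (Suc n - i) * (K ^^ i) f x)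
     = (-1) ^ Suc n * \<Lambda> ^ Suc n * f x
       + (\<Sum>i\<le>n. real (Suc n choose Suc i) * \<Lambda> ^ Suc n * (-1) ^ (n - i) * (K ^^ Suc i) f x)"
    by (subst sum.atMost_Suc_shift) simp
  also have "(\<Sum>i\<le>n. real (Suc n choose Suc i) * \<Lambda> ^ Suc n * (-1) ^ (n - i) * (K ^^ Suc i) f x)
     = \<Lambda> * (\<Sum>i\<le>n. real (n choose i) * \<Lambda> ^ n * (-1) ^ (n - i) * (K ^^ Suc i) f x)
     + (\<Sum>i\<le>n. real (n choose Suc i) * \<Lambda> ^ Suc n * (-1) ^ (n - i) * (K ^^ Suc i) f x)"
    by (simp add: algebra_simps sum.distrib sum_distrib_left)
  also have "(\<Sum>i\<le>n. real (n choose Suc i) * \<Lambda> ^ Suc n * (-1) ^ (n - i) * (K ^^ Suc i) f x)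
     = (\<Sum>i\<le>n. - (real (n choose Suc i) * \<Lambda> ^ Suc n * (-1) ^ (n - Suc i) * (K ^^ Suc i) f x))"
  proof (rule sum.cong[OF refl])
    fix i assume "i \<in> {..n}"
    then show "real (n choose Suc i) * \<Lambda> ^ Suc n * (-1) ^ (n - i) * (K ^^ Suc i) f x
       = - (real (n choose Suc i) * \<Lambda> ^ Suc n * (-1) ^ (n - Suc i) * (K ^^ Suc i) f x)"
      by (cases "i = n") (auto simp: Suc_diff_Suc[symmetric] dest!: le_neq_implies_less)
  qed
  also have "\<dots> = - (\<Sum>i\<le>Suc n. real (n choose i) * \<Lambda> ^ Suc n * (-1) ^ (n - i) * (K ^^ i) f x)
       + (-1) ^ n * \<Lambda> ^ Suc n * f x"
    by (subst sum.atMost_Suc_shift) (simp add: sum_negf)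
  also have "(\<Sum>i\<le>Suc n. real (n choose i) * \<Lambda> ^ Suc n * (-1) ^ (n - i) * (K ^^ i) f x)
      = \<Lambda> * (\<Sum>i\<le>n. real (n choose i) * \<Lambda> ^ n * (-1) ^ (n - i) * (K ^^ i) f x)"
    by (simp add: sum_distrib_left algebra_simps)
  finally show ?case
    using L[OF Suc.prems, of "(L ^^ n) f"] Suc.IH[OF Suc.prems]
    by (simp add: KL algebra_simps)
qed simp

lemma poisson_summable:
  assumes f: "\<And>y. y \<in> S \<Longrightarrow> \<bar>f y\<bar> \<le> C" and x: "x \<in> S"
  shows "summable (\<lambda>n. \<bar>s ^ n / fact n * (K ^^ n) f x\<bar>)"
proof (rule summable_comparison_test)
  have "\<bar>(K ^^ n) f x\<bar> \<le> C" for n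
    using bounds_power[of "-C" f C x n] f x by (force simp: abs_le_iff)
  then show "\<exists>N. \<forall>n\<ge>N. norm \<bar>s ^ n / fact n * (K ^^ n) f x\<bar> \<le> \<bar>s\<bar> ^ n / fact n * C"
    by (auto simp: abs_mult power_abs intro!: mult_left_mono divide_right_mono)
  show "summable (\<lambda>n. \<bar>s\<bar> ^ n / fact n * C)"
    using summable_mult2[OF summable_exp_generic[of "\<bar>s\<bar>"], of C]
    by (simp add: divide_inverse mult_ac)
qed

text \<open>
  The factorisation \<open>exp (t * L) = exp (- \<Lambda> * t) * exp (\<Lambda> * t * K)\<close>, obtained as a Cauchy product of
  power series. It exhibits the semigroup as a Poisson mixture of powers of \<open>K\<close>, in particular as
  positive.
\<close>

lemma uniformization:
  assumes L: "\<And>f x. x \<in> S \<Longrightarrow> L f x = \<Lambda> * (K f x - f x)" and x: "x \<in> S"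
  shows "(\<lambda>n. exp (- (\<Lambda> * t)) * ((\<Lambda> * t) ^ n / fact n) * (K ^^ n) f x)
           sums (\<Sum>n. t ^ n / fact n * (L ^^ n) f x)"
proof -
  define s where "s = \<Lambda> * t"
  define C where "C = Max ((\<lambda>y. \<bar>f y\<bar>) ` S)"
  have C: "\<bar>f y\<bar> \<le> C" if "y \<in> S" for y
    using that finite_S by (auto simp: C_def)
  define a where "a n = s ^ n / fact n * (K ^^ n) f x" for n
  define e where "e n = (- s) ^ n / fact n" for n
  have sa: "summable (\<lambda>n. norm (a n))"
    using poisson_summable[of f C x s] C x by (simp add: a_def)
  have se: "summable (\<lambda>n. norm (e n))"
    using summable_norm_exp[of "-s"] by (simp add: e_def divide_inverse mult_ac)
  have e_sum: "(\<Sum>n. e n) = exp (- s)"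
    by (simp add: e_def exp_def divide_inverse mult_ac)
  have "(\<Sum>i\<le>n. a i * e (n - i)) = t ^ n / fact n * (L ^^ n) f x" for n
  proof -
    have "a i * e (n - i) = t ^ n / fact n * (real (n choose i) * \<Lambda> ^ n * (-1) ^ (n - i) * (K ^^ i) f x)"
      if "i \<le> n" for i
    proof -
      have "s ^ i * (- s) ^ (n - i) = s ^ i * ((-1) ^ (n - i) * s ^ (n - i))"
        using power_minus[of s "n - i"] by simp
      also have "\<dots> = (-1) ^ (n - i) * s ^ n" using that by (simp flip: power_add)
      also have "\<dots> = (-1) ^ (n - i) * (\<Lambda> ^ n * t ^ n)" by (simp add: s_def power_mult_distrib)
      finally show ?thesis
        using that unfolding a_def e_def binomial_fact[OF that] by (simp add: field_simps)
    qed
    then have "(\<Sum>i\<le>n. a i * e (n - i))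
      = t ^ n / fact n * (\<Sum>i\<le>n. real (n choose i) * \<Lambda> ^ n * (-1) ^ (n - i) * (K ^^ i) f x)"
      unfolding sum_distrib_left by (intro sum.cong) auto
    then show ?thesis using uniformization_binomial[of L \<Lambda> x n f] L x by simp
  qed
  then have "(\<lambda>n. t ^ n / fact n * (L ^^ n) f x) sums ((\<Sum>n. a n) * exp (- s))"
    using Cauchy_product_sums[OF sa se] e_sum by simp
  moreover have "(\<lambda>n. exp (- s) * a n) sums (exp (- s) * (\<Sum>n. a n))"
    using sa summable_norm_cancel by (intro sums_mult summable_sums) blast
  ultimately show ?thesis by (simp add: sums_iff a_def s_def mult_ac)
qed

end

section \<open>Poisson averages\<close>

lemma poisson_sums: "(\<lambda>n. exp (- s) * (s ^ n / fact n)) sums (1::real)"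
proof -
  have "(\<lambda>n. s ^ n / fact n) sums exp s"
    using exp_converges[of s] by (simp add: divide_inverse mult.commute)
  from sums_mult[OF this, of "exp (- s)"] show ?thesis by (simp flip: exp_add)
qed

lemma poisson_mean_sums: "(\<lambda>n. exp (- s) * (s ^ n / fact n) * real n) sums (s::real)"
proof -
  have eq: "exp (- s) * (s ^ Suc n / fact (Suc n)) * real (Suc n) = s * (exp (- s) * (s ^ n / fact n))" for n
    by (simp add: field_simps del: of_nat_Suc)
  have "(\<lambda>n. exp (- s) * (s ^ Suc n / fact (Suc n)) * real (Suc n)) sums s"
    unfolding eq using sums_mult[OF poisson_sums[of s], of s] by simp
  from sums_Suc[OF this] show ?thesis by simp
qed

text \<open>
  The second error term bounds the probability that a Poisson variable of mean \<open>s\<close> is below \<open>n0\<close>: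
  there its weights are at most \<open>2 ^ n0 * exp (- s / 2)\<close> times those of mean \<open>s / 2\<close>.
\<close>

lemma poisson_average_bound:
  fixes a :: "nat \<Rightarrow> real"
  assumes A: "(\<lambda>n. exp (- s) * (s ^ n / fact n) * a n) sums A"
    and s: "0 \<le> s" and "0 \<le> \<delta>"
    and one: "\<And>n. \<bar>a n - l\<bar> \<le> 1" and late: "\<And>n. n0 \<le> n \<Longrightarrow> \<bar>a n - l\<bar> \<le> \<delta>"
  shows "\<bar>A - l\<bar> \<le> \<delta> + 2 ^ n0 * exp (- s / 2)"
proof -
  define w where "w n = exp (- s) * (s ^ n / fact n)" for n
  define b where "b n = 2 ^ n0 * exp (- s / 2) * (exp (- (s / 2)) * ((s / 2) ^ n / fact n))" for n
  have w0: "0 \<le> w n" "0 \<le> b n" for n using s by (auto simp: w_def b_def)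
  have wb: "w n \<le> b n" if "n < n0" for n
  proof -
    have "w n = 2 ^ n * (exp (- s / 2) * (exp (- (s / 2)) * ((s / 2) ^ n / fact n)))"
      by (simp add: w_def power_divide flip: exp_add mult.assoc)
    also have "\<dots> \<le> 2 ^ n0 * (exp (- s / 2) * (exp (- (s / 2)) * ((s / 2) ^ n / fact n)))"
      using that s by (intro mult_right_mono power_increasing) auto
    finally show ?thesis by (simp add: b_def mult.assoc)
  qed
  have bound: "\<bar>w n * (a n - l)\<bar> \<le> \<delta> * w n + b n" for n
  proof (cases "n < n0")
    case True
    have "\<bar>w n * (a n - l)\<bar> \<le> w n * 1"
      unfolding abs_mult using w0[of n] one[of n] by (intro mult_mono) auto
    then show ?thesis using wb[OF True] mult_nonneg_nonneg[OF \<open>0 \<le> \<delta>\<close> w0(1)[of n]] by linarith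
  next
    case False
    have "\<bar>w n * (a n - l)\<bar> \<le> w n * \<delta>"
      unfolding abs_mult using w0[of n] late[of n] False by (intro mult_mono) auto
    then show ?thesis using w0[of n] by (simp add: mult.commute)
  qed
  have diff: "(\<lambda>n. w n * (a n - l)) sums (A - l)"
    using sums_diff[OF A sums_mult2[OF poisson_sums[of s], of l]] by (simp add: w_def algebra_simps diff_divide_distrib)
  have tot: "(\<lambda>n. \<delta> * w n + b n) sums (\<delta> * 1 + 2 ^ n0 * exp (- s / 2) * 1)"
    unfolding w_def b_def by (intro sums_add sums_mult poisson_sums)
  have "A - l \<le> \<delta> * 1 + 2 ^ n0 * exp (- s / 2) * 1"
    by (rule sums_le[OF abs_le_D1[OF bound] diff tot])
  moreover have "- (A - l) \<le> \<delta> * 1 + 2 ^ n0 * exp (- s / 2) * 1"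
    by (rule sums_le[OF abs_le_D2[OF bound] sums_minus[OF diff] tot])
  ultimately show ?thesis by simp
qed

section \<open>Holes, adjacent pairs and jumps\<close>

text \<open>
  For a particle at \<open>x\<close>, this is the number of the gap that contains it.
\<close>

definition holes_before :: "config \<Rightarrow> nat \<Rightarrow> nat" where
  "holes_before \<xi> x = card {y \<in> {1..<x}. \<xi> y = 0}"

definition pair_at :: "config \<Rightarrow> nat \<Rightarrow> bool" where
  "pair_at \<xi> x \<longleftrightarrow> \<xi> x = 1 \<and> \<xi> (Suc x) = 1"

definition pairs_before :: "config \<Rightarrow> nat \<Rightarrow> nat" where
  "pairs_before \<xi> x = card {y \<in> {1..<x}. pair_at \<xi> y}"

definition right_jumps :: "nat \<Rightarrow> config \<Rightarrow> nat set" where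
  "right_jumps N \<xi> = {x \<in> {2..N - 1}. \<xi> (x - 1) = 1 \<and> \<xi> x = 1 \<and> \<xi> (Suc x) = 0}"

definition left_jumps :: "nat \<Rightarrow> config \<Rightarrow> nat set" where
  "left_jumps N \<xi> = {x \<in> {2..N - 1}. \<xi> (x - 1) = 0 \<and> \<xi> x = 1 \<and> \<xi> (Suc x) = 1}"

definition swap :: "config \<Rightarrow> nat \<Rightarrow> config" where
  "swap \<xi> x = \<xi>(x := \<xi> (Suc x), Suc x := \<xi> x)"

definition particle_sum :: "nat \<Rightarrow> (nat \<Rightarrow> real) \<Rightarrow> config \<Rightarrow> real" where
  "particle_sum N \<phi> \<xi> = (\<Sum>x\<in>{x \<in> {1..N}. \<xi> x = 1}. \<phi> (holes_before \<xi> x))"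

definition pair_sum :: "nat \<Rightarrow> (nat \<Rightarrow> nat \<Rightarrow> real) \<Rightarrow> config \<Rightarrow> real" where
  "pair_sum N \<psi> \<xi> = (\<Sum>x\<in>{x \<in> {1..<N}. pair_at \<xi> x}. \<psi> (pairs_before \<xi> x) (holes_before \<xi> x))"

lemma finite_jumps [simp]: "finite (right_jumps N \<xi>)" "finite (left_jumps N \<xi>)"
  by (auto simp: right_jumps_def left_jumps_def)

lemma exchange_Suc: "exchange \<xi> x (Suc x) = swap \<xi> x" "exchange \<xi> (Suc x) x = swap \<xi> x"
  by (auto simp: exchange_def swap_def transpose_def fun_eq_iff)

lemma swap_swap [simp]: "swap (swap \<xi> x) x = \<xi>"
  by (auto simp: swap_def fun_eq_iff)

lemma card_below_Suc:
  "card {y \<in> {1..<Suc x}. P y} = card {y \<in> {1..<x}. P y} + (if 1 \<le> x \<and> P x then 1 else 0)"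
proof -
  have "{y \<in> {1..<Suc x}. P y} = (if 1 \<le> x \<and> P x then insert x {y \<in> {1..<x}. P y} else {y \<in> {1..<x}. P y})"
    by (auto simp: less_Suc_eq)
  then show ?thesis by simp
qed

lemma holes_before_Suc [simp]:
  "holes_before \<xi> (Suc x) = holes_before \<xi> x + (if 1 \<le> x \<and> \<xi> x = 0 then 1 else 0)"
  unfolding holes_before_def by (rule card_below_Suc)

lemma pairs_before_Suc [simp]:
  "pairs_before \<xi> (Suc x) = pairs_before \<xi> x + (if 1 \<le> x \<and> pair_at \<xi> x then 1 else 0)"
  unfolding pairs_before_def by (rule card_below_Suc)

lemma before_0 [simp]: "holes_before \<xi> 0 = 0" "pairs_before \<xi> 0 = 0"
  by (auto simp: holes_before_def pairs_before_def)

lemma holes_before_swap: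
  assumes "1 \<le> x" "\<xi> x = 1" "\<xi> (Suc x) = 0"
  shows "holes_before (swap \<xi> x) y = holes_before \<xi> y + (if y = Suc x then 1 else 0)"
  by (induction y) (use assms in \<open>auto simp: swap_def\<close>)

text \<open>
  The jump \<open>1101 \<rightarrow> 1011\<close> moves the pair at \<open>x\<close> to \<open>x + 2\<close> and no pair lies in between, so the order
  of the pairs is preserved.
\<close>

lemma pairs_before_swap:
  assumes "1 \<le> x" "\<xi> x = 1" "\<xi> (x + 1) = 1" "\<xi> (x + 2) = 0" "\<xi> (x + 3) = 1"
  shows "pairs_before (swap \<xi> (Suc x)) y
       = pairs_before \<xi> y - (if x < y \<and> y \<le> x + 2 then 1 else 0)"
proof (induction y)
  case (Suc y)
  have 1: "pair_at (swap \<xi> (Suc x)) z \<longleftrightarrow> (pair_at \<xi> z \<and> z \<noteq> x) \<or> z = x + 2" for z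
    using assms by (auto simp: pair_at_def swap_def eval_nat_numeral)
  have 2: "pair_at \<xi> x" "\<not> pair_at \<xi> (x + 1)" "\<not> pair_at \<xi> (x + 2)"
    using assms by (auto simp: pair_at_def eval_nat_numeral)
  have 3: "1 \<le> pairs_before \<xi> y" if "x < y" "y \<le> x + 2"
  proof -
    have "x \<in> {z \<in> {1..<y}. pair_at \<xi> z}" using that assms 2 by auto
    then have "0 < card {z \<in> {1..<y}. pair_at \<xi> z}" by (subst card_gt_0_iff) auto
    then show ?thesis unfolding pairs_before_def by linarith
  qed
  consider "y < x" | "y = x" | "y = x + 1" | "y = x + 2" | "y > x + 2" by linarith
  then show ?case
    by cases (use Suc 1 2 3 assms(1) in \<open>simp_all\<close>)
qed simp

text \<open>
  When a particle passes a hole to its right, only its own gap number changes.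
\<close>

lemma particle_sum_swap:
  assumes "1 \<le> x" "Suc x \<le> N" "\<xi> x = 1" "\<xi> (Suc x) = 0"
  shows "particle_sum N \<phi> (swap \<xi> x)
       = particle_sum N \<phi> \<xi> + \<phi> (holes_before \<xi> x + 1) - \<phi> (holes_before \<xi> x)"
proof -
  define P where "P = {y \<in> {1..N}. \<xi> y = 1}"
  have P': "{y \<in> {1..N}. swap \<xi> x y = 1} = insert (Suc x) (P - {x})"
    using assms by (auto simp: P_def swap_def split: if_splits)
  have "Suc x \<notin> P" "x \<in> P" "finite P" using assms by (auto simp: P_def)
  have "particle_sum N \<phi> (swap \<xi> x)
      = \<phi> (holes_before (swap \<xi> x) (Suc x)) + (\<Sum>y\<in>P - {x}. \<phi> (holes_before (swap \<xi> x) y))"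
    unfolding particle_sum_def P' using \<open>Suc x \<notin> P\<close> \<open>finite P\<close> by (subst sum.insert) auto
  also have "(\<Sum>y\<in>P - {x}. \<phi> (holes_before (swap \<xi> x) y)) = (\<Sum>y\<in>P - {x}. \<phi> (holes_before \<xi> y))"
    using \<open>Suc x \<notin> P\<close> by (intro sum.cong) (auto simp: holes_before_swap[OF assms(1,3,4)])
  also have "\<dots> = particle_sum N \<phi> \<xi> - \<phi> (holes_before \<xi> x)"
    unfolding particle_sum_def P_def[symmetric]
    using \<open>x \<in> P\<close> \<open>finite P\<close> by (simp add: sum_diff1)
  finally show ?thesis by (simp only: holes_before_swap[OF assms(1,3,4)]) (use assms in simp)
qed

text \<open>
  This is the inverse move, so the formula follows from the one for the right move.
\<close>

lemma particle_sum_swap_left: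
  assumes "1 \<le> x" "Suc x \<le> N" "\<xi> x = 0" "\<xi> (Suc x) = 1"
  shows "particle_sum N \<phi> (swap \<xi> x)
       = particle_sum N \<phi> \<xi> + \<phi> (holes_before \<xi> x) - \<phi> (holes_before \<xi> x + 1)"
proof -
  have *: "1 \<le> x" "Suc x \<le> N" "swap \<xi> x x = 1" "swap \<xi> x (Suc x) = 0"
    using assms by (auto simp: swap_def)
  show ?thesis
    using particle_sum_swap[OF *, of \<phi>] holes_before_swap[OF *(1,3,4), of x] by simp
qed

lemma pair_sum_swap:
  assumes "1 \<le> x" "x + 3 \<le> N" "\<xi> x = 1" "\<xi> (x + 1) = 1" "\<xi> (x + 2) = 0" "\<xi> (x + 3) = 1"
  shows "pair_sum N \<psi> (swap \<xi> (Suc x)) = pair_sum N \<psi> \<xi>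
       + \<psi> (pairs_before \<xi> x) (holes_before \<xi> x + 1) - \<psi> (pairs_before \<xi> x) (holes_before \<xi> x)"
proof -
  let ?\<xi> = "swap \<xi> (Suc x)"
  define P where "P = {y \<in> {1..<N}. pair_at \<xi> y}"
  have H: "holes_before ?\<xi> y = holes_before \<xi> y + (if y = x + 2 then 1 else 0)" for y
    using holes_before_swap[of "Suc x" \<xi> y] assms by simp
  note R = pairs_before_swap[OF assms(1,3-6)]
  have 1: "pair_at ?\<xi> z \<longleftrightarrow> (pair_at \<xi> z \<and> z \<noteq> x) \<or> z = x + 2" for z
    using assms by (auto simp: pair_at_def swap_def eval_nat_numeral)
  have 2: "pair_at \<xi> x" "\<not> pair_at \<xi> (x + 1)" "\<not> pair_at \<xi> (x + 2)"
    using assms by (auto simp: pair_at_def eval_nat_numeral)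
  have P': "{y \<in> {1..<N}. pair_at ?\<xi> y} = insert (x + 2) (P - {x})"
    using assms(1,2) by (auto simp: P_def 1)
  have P: "x + 2 \<notin> P" "x + 1 \<notin> P" "x \<in> P" "finite P" using assms 2 by (auto simp: P_def)
  have e: "pairs_before ?\<xi> (x + 2) = pairs_before \<xi> x"
    "holes_before ?\<xi> (x + 2) = holes_before \<xi> x + 1"
    unfolding R H using 2 assms by (auto simp: numeral_2_eq_2)
  have "pair_sum N \<psi> ?\<xi> = \<psi> (pairs_before \<xi> x) (holes_before \<xi> x + 1)
      + (\<Sum>y\<in>P - {x}. \<psi> (pairs_before ?\<xi> y) (holes_before ?\<xi> y))"
    unfolding pair_sum_def P' e[symmetric] using P by (subst sum.insert) auto
  also have "(\<Sum>y\<in>P - {x}. \<psi> (pairs_before ?\<xi> y) (holes_before ?\<xi> y))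
      = (\<Sum>y\<in>P - {x}. \<psi> (pairs_before \<xi> y) (holes_before \<xi> y))"
  proof (rule sum.cong[OF refl])
    fix y assume "y \<in> P - {x}"
    then have "y \<noteq> x" "y \<noteq> x + 1" "y \<noteq> x + 2" using P by auto
    then show "\<psi> (pairs_before ?\<xi> y) (holes_before ?\<xi> y) = \<psi> (pairs_before \<xi> y) (holes_before \<xi> y)"
      unfolding R H by auto
  qed
  also have "\<dots> = pair_sum N \<psi> \<xi> - \<psi> (pairs_before \<xi> x) (holes_before \<xi> x)"
    unfolding pair_sum_def P_def[symmetric] using P by (simp add: sum_diff1)
  finally show ?thesis by simp
qed

lemma pair_sum_swap_left:
  assumes "1 \<le> x" "x + 3 \<le> N" "\<xi> x = 1" "\<xi> (x + 1) = 0" "\<xi> (x + 2) = 1" "\<xi> (x + 3) = 1"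
  shows "pair_sum N \<psi> (swap \<xi> (Suc x)) = pair_sum N \<psi> \<xi>
       + \<psi> (pairs_before \<xi> x) (holes_before \<xi> x) - \<psi> (pairs_before \<xi> x) (holes_before \<xi> x + 1)"
proof -
  let ?\<xi> = "swap \<xi> (Suc x)"
  have *: "1 \<le> x" "x + 3 \<le> N" "?\<xi> x = 1" "?\<xi> (x + 1) = 1" "?\<xi> (x + 2) = 0" "?\<xi> (x + 3) = 1"
    using assms by (simp_all add: swap_def numeral_2_eq_2 numeral_3_eq_3)
  show ?thesis
    using pair_sum_swap[OF *, of \<psi>] holes_before_swap[of "Suc x" ?\<xi> x]
      pairs_before_swap[OF *(1,3-6), of x] * by simp
qed

lemma config_values:
  assumes "\<xi> \<in> fep_configs N k" "1 \<le> x" "x \<le> N" shows "\<xi> x = 0 \<or> \<xi> x = 1"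
  using assms unfolding fep_configs_def PiE_iff by auto

lemma finite_fep_configs: "finite (fep_configs N k)"
proof -
  have "finite ({1..N} \<rightarrow>\<^sub>E {0, 1::nat})" by (intro finite_PiE) auto
  then show ?thesis by (simp add: fep_configs_def)
qed

lemma swap_config:
  assumes \<xi>: "\<xi> \<in> fep_configs N k" and x: "1 \<le> x" "Suc x \<le> N"
  shows "swap \<xi> x \<in> fep_configs N k"
proof -
  have "(\<Sum>y=1..N. swap \<xi> x y) = (\<Sum>y=1..N. \<xi> y)"
  proof -
    have "(\<Sum>y=1..N. \<xi> y) = (\<Sum>y\<in>{1..N}. \<xi> (transpose x (Suc x) y))"
      by (rule sum.reindex_bij_witness[of _ "transpose x (Suc x)" "transpose x (Suc x)"])
         (use x in \<open>auto simp: transpose_def\<close>)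
    moreover have "swap \<xi> x = \<xi> \<circ> transpose x (Suc x)"
      by (simp flip: exchange_Suc add: exchange_def)
    ultimately show ?thesis by simp
  qed
  moreover have "swap \<xi> x \<in> {1..N} \<rightarrow>\<^sub>E {0, 1}"
    using \<xi> x unfolding fep_configs_def swap_def by (auto simp: PiE_iff extensional_def)
  ultimately show ?thesis using \<xi> by (simp add: fep_configs_def)
qed

lemma generator_jumps:
  assumes \<xi>: "\<xi> \<in> fep_configs N k"
  shows "fep_generator p q N f \<xi> = p * (\<Sum>x\<in>right_jumps N \<xi>. f (swap \<xi> x) - f \<xi>)
       + q * (\<Sum>x\<in>left_jumps N \<xi>. f (swap \<xi> (x - 1)) - f \<xi>)"
proof -
  have v: "\<xi> (x - 1) \<in> {0, 1} \<and> \<xi> x \<in> {0, 1} \<and> \<xi> (x + 1) \<in> {0, 1}" if "x \<in> {2..N - 1}" for x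
    using config_values[OF \<xi>, of "x - 1"] config_values[OF \<xi>, of x] config_values[OF \<xi>, of "x + 1"] that
    by auto
  have "(\<Sum>x=2..N - 1. p * real (\<xi> x) * real (\<xi> (x - 1)) * (1 - real (\<xi> (x + 1)))
        * (f (exchange \<xi> x (x + 1)) - f \<xi>))
      = (\<Sum>x=2..N - 1. if \<xi> (x - 1) = 1 \<and> \<xi> x = 1 \<and> \<xi> (Suc x) = 0 then p * (f (swap \<xi> x) - f \<xi>) else 0)"
    by (rule sum.cong[OF refl]) (drule v, auto simp: exchange_Suc)
  moreover have "(\<Sum>x=2..N - 1. q * real (\<xi> x) * real (\<xi> (x + 1)) * (1 - real (\<xi> (x - 1)))
        * (f (exchange \<xi> x (x - 1)) - f \<xi>))
      = (\<Sum>x=2..N - 1. if \<xi> (x - 1) = 0 \<and> \<xi> x = 1 \<and> \<xi> (Suc x) = 1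
           then q * (f (swap \<xi> (x - 1)) - f \<xi>) else 0)"
  proof (rule sum.cong[OF refl])
    fix x assume x: "x \<in> {2..N - 1}"
    then have "exchange \<xi> x (x - 1) = swap \<xi> (x - 1)"
      using exchange_Suc(2)[of \<xi> "x - 1"] by simp
    then show "q * real (\<xi> x) * real (\<xi> (x + 1)) * (1 - real (\<xi> (x - 1))) * (f (exchange \<xi> x (x - 1)) - f \<xi>)
      = (if \<xi> (x - 1) = 0 \<and> \<xi> x = 1 \<and> \<xi> (Suc x) = 1 then q * (f (swap \<xi> (x - 1)) - f \<xi>) else 0)"
      using v[OF x] by auto
  qed
  ultimately show ?thesis
    unfolding fep_generator_def right_jumps_def left_jumps_def sum_distrib_left
    by (simp only: sum.inter_filter[OF finite_atLeastAtMost])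
qed

text \<open>
  A left jump at \<open>x\<close> means that \<open>x\<close> starts a cluster of at least two particles (a pair at \<open>x\<close>, none
  at \<open>x - 1\<close>), and a right jump at \<open>x\<close> means that \<open>x\<close> ends one (a pair at \<open>x - 1\<close>, none at \<open>x\<close>).
  The difference of the two sums is therefore the sum of \<open>a x * (b x - b (x - 1))\<close>, with \<open>b\<close> the
  indicator of pairs, and it telescopes up to the growth factor \<open>\<kappa>\<close> of the weights inside clusters.
\<close>

lemma jump_balance:
  fixes a :: "nat \<Rightarrow> real"
  assumes \<xi>: "\<xi> \<in> fep_configs N k" and N: "2 \<le> N"
    and a: "\<And>x. 1 \<le> x \<Longrightarrow> Suc x < N \<Longrightarrow> pair_at \<xi> x \<Longrightarrow> a (Suc x) = \<kappa> * a x"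
  shows "(\<Sum>x\<in>left_jumps N \<xi>. a x) - (\<Sum>x\<in>right_jumps N \<xi>. a x)
       = a (N - 1) * of_bool (pair_at \<xi> (N - 1)) - a 1 * of_bool (pair_at \<xi> 1)
         - (\<kappa> - 1) * (\<Sum>x=1..N - 2. a x * of_bool (pair_at \<xi> x))"
proof -
  obtain n where n: "N = Suc (Suc n)" using N by (metis add_2_eq_Suc le_Suc_ex)
  define b where "b x = (of_bool (pair_at \<xi> x) :: real)" for x
  have "(\<Sum>x\<in>left_jumps N \<xi>. a x) - (\<Sum>x\<in>right_jumps N \<xi>. a x)
      = (\<Sum>x=2..N - 1. (if \<xi> (x - 1) = 0 \<and> \<xi> x = 1 \<and> \<xi> (Suc x) = 1 then a x else 0)
           - (if \<xi> (x - 1) = 1 \<and> \<xi> x = 1 \<and> \<xi> (Suc x) = 0 then a x else 0))"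
    unfolding right_jumps_def left_jumps_def sum_subtractf
    by (simp only: sum.inter_filter[OF finite_atLeastAtMost])
  also have "\<dots> = (\<Sum>x=2..N - 1. a x * b x - a x * b (x - 1))"
  proof (rule sum.cong[OF refl])
    fix x assume x: "x \<in> {2..N - 1}"
    have "\<xi> (x - 1) \<in> {0, 1} \<and> \<xi> x \<in> {0, 1} \<and> \<xi> (Suc x) \<in> {0, 1}"
      using config_values[OF \<xi>, of "x - 1"] config_values[OF \<xi>, of x] config_values[OF \<xi>, of "x + 1"] x
      by auto
    then show "(if \<xi> (x - 1) = 0 \<and> \<xi> x = 1 \<and> \<xi> (Suc x) = 1 then a x else 0)
           - (if \<xi> (x - 1) = 1 \<and> \<xi> x = 1 \<and> \<xi> (Suc x) = 0 then a x else 0) = a x * b x - a x * b (x - 1)"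
      using x by (auto simp: b_def pair_at_def)
  qed
  also have "\<dots> = (\<Sum>x=Suc 1..Suc n. a x * b x - a x * b (x - 1))" by (simp add: n numeral_2_eq_2)
  also have "\<dots> = (\<Sum>x=1..n. a (Suc x) * b (Suc x) - a (Suc x) * b x)"
    by (subst sum.shift_bounds_cl_Suc_ivl) simp
  also have "\<dots> = (\<Sum>x=1..n. a (Suc x) * b (Suc x) - \<kappa> * (a x * b x))"
    by (intro sum.cong) (auto simp: b_def n a)
  also have "\<dots> = (\<Sum>x=1..n. (a (Suc x) * b (Suc x) - a x * b x) - (\<kappa> - 1) * (a x * b x))"
    by (simp add: algebra_simps)
  also have "\<dots> = a (Suc n) * b (Suc n) - a 1 * b 1 - (\<kappa> - 1) * (\<Sum>x=1..n. a x * b x)"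
    unfolding sum_subtractf[of "\<lambda>x. a (Suc x) * b (Suc x) - a x * b x"] sum_distrib_left
    by (subst sum_Suc_diff[of 1 n "\<lambda>x. a x * b x"]) auto
  finally show ?thesis by (simp add: b_def n)
qed

section \<open>The uniformised exclusion process\<close>

lemma holes_before_mono: "x \<le> y \<Longrightarrow> holes_before \<xi> x \<le> holes_before \<xi> y"
  unfolding holes_before_def by (intro card_mono) auto

locale fep =
  fixes p q :: real and N k :: nat
  assumes p_gt: "1/2 < p" and p_lt: "p < 1" and q_eq: "q = 1 - p"
    and dense: "N < 2 * k" and hole: "k < N"
begin

definition m :: nat where "m = N - k"
definition lam :: real where "lam = q / p"
abbreviation "\<Omega> \<equiv> fep_configs N k"
abbreviation "\<E> \<equiv> fep_ergodic N k"
abbreviation "L \<equiv> fep_generator p q N"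
text \<open>
  The total jump rate is at most \<open>N\<close>. Uniformising at rate \<open>2 * N\<close> gives a chain
  that stays put with probability at least \<open>1/2\<close>; this lets a path to a state be padded to any length.
\<close>

definition K :: "(config \<Rightarrow> real) \<Rightarrow> config \<Rightarrow> real" where
  "K f \<xi> = f \<xi> + L f \<xi> / (2 * real N)"

lemma basic: "0 < q" "q < p" "q < 1/2" "0 < p" "0 < lam" "lam < 1" "3 \<le> N" "1 \<le> m" "m \<le> N"
  using p_gt p_lt q_eq dense hole unfolding m_def lam_def by (auto simp: field_simps)

lemma zero_or_one: "\<xi> \<in> \<Omega> \<Longrightarrow> 1 \<le> x \<Longrightarrow> x \<le> N \<Longrightarrow> \<xi> x = 0 \<or> \<xi> x = 1"
  by (rule config_values)

lemma ergodic_config: "\<xi> \<in> \<E> \<Longrightarrow> \<xi> \<in> \<Omega>"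
  by (simp add: fep_ergodic_def)

lemma total_holes:
  assumes "\<xi> \<in> \<Omega>" shows "holes_before \<xi> (Suc N) = m"
proof -
  have "holes_before \<xi> (Suc N) = (\<Sum>x\<in>{1..N}. if \<xi> x = 0 then 1 else 0)"
    unfolding holes_before_def atLeastLessThanSuc_atLeastAtMost
    by (simp add: sum.inter_filter[symmetric])
  moreover have "(\<Sum>x\<in>{1..N}. if \<xi> x = 0 then 1 else 0) + (\<Sum>x=1..N. \<xi> x) = (\<Sum>x\<in>{1..N}. 1)"
    unfolding sum.distrib[symmetric] using zero_or_one[OF assms] by (intro sum.cong) fastforce+
  moreover have "(\<Sum>x=1..N. \<xi> x) = k" using assms by (simp add: fep_configs_def)
  ultimately show ?thesis by (simp add: m_def)
qed

lemma holes_before_le: "\<xi> \<in> \<Omega> \<Longrightarrow> x \<le> Suc N \<Longrightarrow> holes_before \<xi> x \<le> m"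
  using holes_before_mono[of x "Suc N" \<xi>] total_holes by simp

lemma holes_before_less:
  assumes "\<xi> \<in> \<Omega>" "x \<le> y" "1 \<le> y" "y \<le> N" "\<xi> y = 0" shows "holes_before \<xi> x < m"
  using holes_before_mono[of x y \<xi>] holes_before_le[of \<xi> "Suc y"] assms by simp

lemma holes_before_last_pair:
  assumes "\<xi> \<in> \<Omega>" "pair_at \<xi> (N - 1)" shows "holes_before \<xi> (N - 1) = m"
proof -
  have "N = Suc (Suc (N - 2))" using basic(7) by simp
  then obtain n where n: "N = Suc (Suc n)" by blast
  show ?thesis using total_holes[OF assms(1)] assms(2) by (auto simp: n pair_at_def split: if_splits)
qed

lemma right_jump_swap: "\<xi> \<in> \<Omega> \<Longrightarrow> x \<in> right_jumps N \<xi> \<Longrightarrow> swap \<xi> x \<in> \<Omega>"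
  by (rule swap_config) (auto simp: right_jumps_def)

lemma left_jump_swap: "\<xi> \<in> \<Omega> \<Longrightarrow> x \<in> left_jumps N \<xi> \<Longrightarrow> swap \<xi> (x - 1) \<in> \<Omega>"
  by (rule swap_config) (auto simp: left_jumps_def)

lemma jump_count: "p * card (right_jumps N \<xi>) + q * card (left_jumps N \<xi>) \<le> real N"
proof -
  have "card (right_jumps N \<xi>) \<le> card {2..N-1}" "card (left_jumps N \<xi>) \<le> card {2..N-1}"
    by (intro card_mono; auto simp: right_jumps_def left_jumps_def)+
  then have "real (card (right_jumps N \<xi>)) \<le> N" "real (card (left_jumps N \<xi>)) \<le> N" by auto
  then have "p * card (right_jumps N \<xi>) + q * card (left_jumps N \<xi>) \<le> p * N + q * N"
    using basic by (intro add_mono mult_left_mono) auto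
  also have "\<dots> = N" by (simp add: q_eq algebra_simps)
  finally show ?thesis .
qed

definition stay :: "config \<Rightarrow> real" where
  "stay \<xi> = 1 - (p * card (right_jumps N \<xi>) + q * card (left_jumps N \<xi>)) / (2 * N)"

lemma stay_ge: "1/2 \<le> stay \<xi>"
  using jump_count[of \<xi>] basic by (simp add: stay_def field_simps)

lemma K_jumps:
  assumes "\<xi> \<in> \<Omega>"
  shows "K f \<xi> = stay \<xi> * f \<xi> + (p / (2 * N)) * (\<Sum>x\<in>right_jumps N \<xi>. f (swap \<xi> x))
      + (q / (2 * N)) * (\<Sum>x\<in>left_jumps N \<xi>. f (swap \<xi> (x - 1)))"
  unfolding K_def generator_jumps[OF assms] stay_def
  using basic by (simp add: sum_subtractf field_simps)

lemma markov_operator_K: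
  assumes T: "T \<subseteq> \<Omega>"
    and right: "\<And>\<xi> x. \<xi> \<in> T \<Longrightarrow> x \<in> right_jumps N \<xi> \<Longrightarrow> swap \<xi> x \<in> T"
    and left: "\<And>\<xi> x. \<xi> \<in> T \<Longrightarrow> x \<in> left_jumps N \<xi> \<Longrightarrow> swap \<xi> (x - 1) \<in> T"
  shows "markov_operator T K"
proof
  show "finite T" using finite_subset[OF T finite_fep_configs] .
next
  fix \<xi> a f b g assume "\<xi> \<in> T"
  then show "K (\<lambda>y. a * f y + b * g y) \<xi> = a * K f \<xi> + b * K g \<xi>"
    using T by (subst (1 2 3) K_jumps) (auto simp: sum.distrib sum_distrib_left[symmetric] algebra_simps)
next
  fix \<xi> and f :: "config \<Rightarrow> real" assume f: "\<And>y. y \<in> T \<Longrightarrow> 0 \<le> f y" and \<xi>: "\<xi> \<in> T"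
  then show "0 \<le> K f \<xi>"
    using T right left stay_ge[of \<xi>] basic
    by (subst K_jumps) (auto intro!: add_nonneg_nonneg mult_nonneg_nonneg divide_nonneg_nonneg sum_nonneg)
next
  fix \<xi> assume "\<xi> \<in> T"
  then show "K (\<lambda>_. 1) \<xi> = 1" using T
    by (subst K_jumps) (auto simp: stay_def add_divide_distrib)
qed

sublocale chain: markov_operator \<Omega> K
  by (rule markov_operator_K) (use right_jump_swap left_jump_swap in auto)

lemma generator_particle_sum:
  assumes \<xi>: "\<xi> \<in> \<Omega>"
  shows "L (particle_sum N \<phi>) \<xi>
    = (\<Sum>x\<in>right_jumps N \<xi>. p * (\<phi> (holes_before \<xi> x + 1) - \<phi> (holes_before \<xi> x)))
    + (\<Sum>x\<in>left_jumps N \<xi>. q * (\<phi> (holes_before \<xi> x - 1) - \<phi> (holes_before \<xi> x)))"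
proof -
  have "particle_sum N \<phi> (swap \<xi> x) - particle_sum N \<phi> \<xi> = \<phi> (holes_before \<xi> x + 1) - \<phi> (holes_before \<xi> x)"
    if "x \<in> right_jumps N \<xi>" for x
    using that by (subst particle_sum_swap) (auto simp: right_jumps_def)
  moreover have "particle_sum N \<phi> (swap \<xi> (x - 1)) - particle_sum N \<phi> \<xi> = \<phi> (holes_before \<xi> x - 1) - \<phi> (holes_before \<xi> x)"
    if x: "x \<in> left_jumps N \<xi>" for x
  proof -
    obtain y where "x = Suc y" "1 \<le> y" using x by (cases x) (auto simp: left_jumps_def)
    then show ?thesis using x particle_sum_swap_left[of y N \<xi> \<phi>] by (auto simp: left_jumps_def)
  qed
  ultimately show ?thesis
    unfolding generator_jumps[OF \<xi>] sum_distrib_left by simp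
qed

lemma right_jump_holes:
  assumes "\<xi> \<in> \<Omega>" "x \<in> right_jumps N \<xi>" shows "holes_before \<xi> x < m"
  by (rule holes_before_less[of \<xi> x "Suc x"]) (use assms in \<open>auto simp: right_jumps_def\<close>)

lemma left_jump_holes:
  assumes "x \<in> left_jumps N \<xi>" shows "1 \<le> holes_before \<xi> x"
proof -
  obtain y where "x = Suc y" "1 \<le> y" using assms by (cases x) (auto simp: left_jumps_def)
  then show ?thesis using assms by (auto simp: left_jumps_def)
qed

section \<open>A potential for the lower bound\<close>

text \<open>
  By harmonicity a jump to the left in gap \<open>i\<close> contributes \<open>(p - q) * lam ^ i\<close> and a jump to the right
  its negative. They cancel for each cluster that has a hole on both sides; a cluster at the
  left end only decreases the sum, and one at the right end lies in gap \<open>m\<close>.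
\<close>

lemma generator_harmonic_sum:
  assumes \<xi>: "\<xi> \<in> \<Omega>"
  shows "L (particle_sum N (\<lambda>i. lam ^ i)) \<xi> \<le> (p - q) * lam ^ m"
proof -
  define a where "a x = lam ^ holes_before \<xi> x" for x
  have pl: "p * lam = q" using basic by (simp add: lam_def)
  have "L (particle_sum N (\<lambda>i. lam ^ i)) \<xi>
     = (\<Sum>x\<in>right_jumps N \<xi>. - (p - q) * a x) + (\<Sum>x\<in>left_jumps N \<xi>. (p - q) * a x)"
    unfolding generator_particle_sum[OF \<xi>]
  proof (intro arg_cong2[where f = "(+)"] sum.cong refl)
    fix x show "p * (lam ^ (holes_before \<xi> x + 1) - lam ^ holes_before \<xi> x) = - (p - q) * a x"
      using pl by (simp add: a_def algebra_simps)
  next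
    fix x assume "x \<in> left_jumps N \<xi>"
    then obtain h where h: "holes_before \<xi> x = Suc h"
      using left_jump_holes by (metis Suc_le_D One_nat_def)
    have "p * lam ^ Suc h = q * lam ^ h" using pl by (metis mult.assoc power_Suc)
    then have "q * (lam ^ h - lam ^ Suc h) = (p - q) * lam ^ Suc h"
      by (simp only: right_diff_distrib left_diff_distrib)
    then show "q * (lam ^ (holes_before \<xi> x - 1) - lam ^ holes_before \<xi> x) = (p - q) * a x"
      by (simp add: a_def h)
  qed
  also have "\<dots> = (p - q) * ((\<Sum>x\<in>left_jumps N \<xi>. a x) - (\<Sum>x\<in>right_jumps N \<xi>. a x))"
    unfolding sum_distrib_left[symmetric] by (simp add: algebra_simps)
  also have "(\<Sum>x\<in>left_jumps N \<xi>. a x) - (\<Sum>x\<in>right_jumps N \<xi>. a x)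
      = a (N - 1) * of_bool (pair_at \<xi> (N - 1)) - a 1 * of_bool (pair_at \<xi> 1) - (1 - 1) * (\<Sum>x=1..N - 2. a x * of_bool (pair_at \<xi> x))"
    by (rule jump_balance[OF \<xi>]) (use basic in \<open>auto simp: a_def pair_at_def\<close>)
  also have "\<dots> \<le> lam ^ m"
  proof -
    have "- 1 \<le> lam ^ m" by (rule order_trans[of _ 0]) (use basic in auto)
    then show ?thesis using holes_before_last_pair[OF \<xi>] basic by (auto simp: a_def)
  qed
  finally show ?thesis using basic by (simp add: mult_left_mono)
qed

section \<open>Escape from the transient configurations\<close>

text \<open>
  The numbers of the empty gaps. An empty gap absorbs the first particle that enters it.
\<close>

definition traps :: "config \<Rightarrow> nat set" where
  "traps \<xi> = {j \<in> {0..m}. \<forall>x\<in>{1..N}. \<xi> x = 1 \<longrightarrow> holes_before \<xi> x \<noteq> j}"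

lemma traps_jump:
  assumes "\<xi> \<in> \<Omega>"
  shows "x \<in> right_jumps N \<xi> \<Longrightarrow> traps (swap \<xi> x) \<subseteq> traps \<xi>"
    and "x \<in> left_jumps N \<xi> \<Longrightarrow> traps (swap \<xi> (x - 1)) \<subseteq> traps \<xi>"
proof -
  assume "x \<in> right_jumps N \<xi>"
  then obtain y where y: "x = Suc y" "1 \<le> y" "y + 2 \<le> N" "\<xi> y = 1" "\<xi> (Suc y) = 1" "\<xi> (Suc (Suc y)) = 0"
    by (cases x) (auto simp: right_jumps_def)
  have H: "holes_before (swap \<xi> (Suc y)) z = holes_before \<xi> z + (if z = Suc (Suc y) then 1 else 0)" for z
    by (rule holes_before_swap) (use y in auto)
  have "\<exists>z'\<in>{1..N}. swap \<xi> x z' = 1 \<and> holes_before (swap \<xi> x) z' = holes_before \<xi> z"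
    if "z \<in> {1..N}" "\<xi> z = 1" for z
  proof (cases "z = Suc y")
    case True
    moreover have "swap \<xi> x y = 1" using y by (simp add: swap_def)
    ultimately show ?thesis using y(2-) True by (intro bexI[of _ y]) (auto simp: H y(1))
  next
    case False
    then have "z \<noteq> Suc (Suc y)" "swap \<xi> x z = 1" using y that by (auto simp: swap_def)
    then show ?thesis using y(2-) that by (intro bexI[of _ z]) (auto simp: H y(1))
  qed
  then show "traps (swap \<xi> x) \<subseteq> traps \<xi>" unfolding traps_def by fastforce
next
  assume "x \<in> left_jumps N \<xi>"
  then obtain y where y: "x = Suc y" "1 \<le> y" "y + 2 \<le> N" "\<xi> y = 0" "\<xi> (Suc y) = 1" "\<xi> (Suc (Suc y)) = 1"
    by (cases x) (auto simp: left_jumps_def)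
  have H: "holes_before \<xi> z = holes_before (swap \<xi> y) z + (if z = Suc y then 1 else 0)" for z
  proof -
    have *: "1 \<le> y" "swap \<xi> y y = 1" "swap \<xi> y (Suc y) = 0" using y by (auto simp: swap_def)
    show ?thesis using holes_before_swap[OF *, of z] by simp
  qed
  have "\<exists>z'\<in>{1..N}. swap \<xi> y z' = 1 \<and> holes_before (swap \<xi> y) z' = holes_before \<xi> z"
    if "z \<in> {1..N}" "\<xi> z = 1" for z
  proof (cases "z = Suc y")
    case True
    have "holes_before (swap \<xi> y) (Suc (Suc y)) = holes_before \<xi> (Suc y)"
      using H[of "Suc (Suc y)"] y by simp
    moreover have "swap \<xi> y (Suc (Suc y)) = 1" using y by (simp add: swap_def)
    ultimately show ?thesis using y True by (intro bexI[of _ "Suc (Suc y)"]) auto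
  next
    case False
    then have "swap \<xi> y z = 1" using y that by (auto simp: swap_def)
    then show ?thesis using False that H[of z] by (intro bexI[of _ z]) auto
  qed
  then show "traps (swap \<xi> (x - 1)) \<subseteq> traps \<xi>" unfolding traps_def using y by fastforce
qed

lemma traps_nonempty:
  assumes \<xi>: "\<xi> \<in> \<Omega>" and "\<xi> \<notin> \<E>"
  shows "traps \<xi> \<noteq> {}"
proof -
  consider "\<xi> 1 = 0" | "\<xi> N = 0" | x where "1 \<le> x" "Suc x \<le> N" "\<xi> x = 0" "\<xi> (Suc x) = 0"
  proof -
    have "\<xi> 1 * \<xi> N = 1" if "\<xi> 1 \<noteq> 0" "\<xi> N \<noteq> 0"
      using zero_or_one[OF \<xi>, of 1] zero_or_one[OF \<xi>, of N] basic that by auto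
    then have "\<xi> 1 = 0 \<or> \<xi> N = 0 \<or> (\<exists>x\<in>{1..N - 1}. \<xi> x + \<xi> (x + 1) < 1)"
      using assms unfolding fep_ergodic_def by force
    then show ?thesis using that by (auto simp: Suc_le_eq)
  qed
  then show ?thesis
  proof cases
    case 1
    have "holes_before \<xi> x \<noteq> 0" if "x \<in> {1..N}" "\<xi> x = 1" for x
    proof -
      have "2 \<le> x" using that 1 by (cases "x = 1") auto
      then have "holes_before \<xi> (Suc (Suc 0)) \<le> holes_before \<xi> x" by (intro holes_before_mono) auto
      then show ?thesis using 1 by simp
    qed
    then have "0 \<in> traps \<xi>" by (auto simp: traps_def)
    then show ?thesis by auto
  next
    case 2
    have "holes_before \<xi> x \<noteq> m" if "x \<in> {1..N}" "\<xi> x = 1" for x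
      using holes_before_less[OF \<xi>, of x N] that 2 basic by force
    then have "m \<in> traps \<xi>" by (auto simp: traps_def)
    then show ?thesis by auto
  next
    case (3 x)
    have "holes_before \<xi> y \<noteq> holes_before \<xi> (Suc x)" if "y \<in> {1..N}" "\<xi> y = 1" for y
    proof -
      have "y \<noteq> x" "y \<noteq> Suc x" using 3 that by auto
      then consider "y < x" | "Suc (Suc x) \<le> y" by linarith
      then show ?thesis
      proof cases
        case 1
        then show ?thesis using holes_before_mono[of y x \<xi>] 3 by simp
      next
        case 2
        then show ?thesis using holes_before_mono[OF 2, of \<xi>] 3 by simp
      qed
    qed
    moreover have "holes_before \<xi> (Suc x) \<le> m" using 3 by (intro holes_before_le[OF \<xi>]) auto
    ultimately have "holes_before \<xi> (Suc x) \<in> traps \<xi>" by (auto simp: traps_def)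
    then show ?thesis by auto
  qed
qed

text \<open>
  Without adjacent particles, summing \<open>\<xi> x + \<xi> (x + 1) \<le> 1\<close> over the \<open>N - 1\<close> bonds gives
  \<open>2 * k \<le> N + 1\<close>. As \<open>N < 2 * k\<close>, equality holds everywhere, and the configuration
  alternates with particles at both ends, which makes it ergodic.
\<close>

lemma exists_pair:
  assumes \<xi>: "\<xi> \<in> \<Omega>" and "\<xi> \<notin> \<E>"
  shows "\<exists>x\<in>{1..N - 1}. pair_at \<xi> x"
proof (rule ccontr)
  assume no: "\<not> ?thesis"
  obtain n where n: "N = Suc n" using basic by (cases N) auto
  have le: "\<xi> x + \<xi> (Suc x) \<le> 1" if "x \<in> {1..n}" for x
    using no zero_or_one[OF \<xi>, of x] zero_or_one[OF \<xi>, of "Suc x"] that by (auto simp: pair_at_def n)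
  have k: "(\<Sum>x=1..N. \<xi> x) = k" using \<xi> by (simp add: fep_configs_def)
  have "(\<Sum>x=1..n. \<xi> x + \<xi> (Suc x)) = (\<Sum>x=1..n. \<xi> x) + (\<Sum>x=Suc 1..Suc n. \<xi> x)"
    by (subst sum.shift_bounds_cl_Suc_ivl) (simp add: sum.distrib)
  moreover have "(\<Sum>x=1..n. \<xi> x) + \<xi> N = k" using k by (simp add: n)
  moreover have "\<xi> 1 + (\<Sum>x=Suc 1..Suc n. \<xi> x) = k"
    using k sum.atLeast_Suc_atMost[of 1 "Suc n" \<xi>] unfolding n by simp
  ultimately have eq: "(\<Sum>x=1..n. \<xi> x + \<xi> (Suc x)) + \<xi> 1 + \<xi> N = 2 * k" by linarith
  have sum_le: "(\<Sum>x=1..n. \<xi> x + \<xi> (Suc x)) \<le> (\<Sum>x=1..n. 1)" by (rule sum_mono) (rule le)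
  have ends: "\<xi> 1 \<le> 1" "\<xi> N \<le> 1"
    using zero_or_one[OF \<xi>, of 1] zero_or_one[OF \<xi>, of N] basic by auto
  have all: "\<xi> x + \<xi> (Suc x) = 1" if "x \<in> {1..n}" for x
  proof (rule ccontr)
    assume "\<xi> x + \<xi> (Suc x) \<noteq> 1"
    then have lt: "\<xi> x + \<xi> (Suc x) < 1" using le[OF that] by linarith
    have "(\<Sum>x=1..n. \<xi> x + \<xi> (Suc x)) < (\<Sum>x=1..n. 1)"
      by (rule sum_strict_mono_ex1[OF finite_atLeastAtMost]) (use le lt that in blast)+
    then show False using eq ends dense n by simp
  qed
  have "\<xi> 1 = 1 \<and> \<xi> N = 1" using eq ends dense n sum_le by simp
  then have "\<xi> \<in> \<E>" using \<xi> all by (auto simp: fep_ergodic_def n)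
  then show False using assms by simp
qed

text \<open>
  Up to an additive constant, the function \<open>walk_time j\<close> is a supersolution of the hitting time
  problem of gap \<open>j\<close> for the walk on the gaps. The linear part has drift \<open>-1\<close> away from the ends. The
  harmonic part, present to the right of \<open>j\<close>, has the coefficient that produces drift exactly \<open>-1\<close>
  at the right end; it is of order \<open>(p / q) ^ m\<close>, the price of moving against the drift. The shift
  by \<open>m\<close> makes the function nonnegative.
\<close>

definition walk_const :: real where "walk_const = p / ((p - q)\<^sup>2 * lam ^ m)"
definition walk_time :: "nat \<Rightarrow> nat \<Rightarrow> real" where
  "walk_time j i = (real m + real j - real i) / (p - q) + walk_const * (lam ^ j - lam ^ max i j)"

lemma walk_const_pos: "0 < walk_const"
  using basic by (simp add: walk_const_def)

lemma walk_time_bounds: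
  assumes "i \<le> m" "j \<le> m"
  shows "0 \<le> walk_time j i" "walk_time j i \<le> 2 * real m / (p - q) + walk_const"
proof -
  have "lam ^ max i j \<le> lam ^ j" using basic by (intro power_decreasing) auto
  moreover have "lam ^ j \<le> 1" "0 \<le> lam ^ max i j" using basic by (auto intro: power_le_one)
  ultimately have "0 \<le> walk_const * (lam ^ j - lam ^ max i j)" "walk_const * (lam ^ j - lam ^ max i j) \<le> walk_const * 1"
    using walk_const_pos by (auto intro!: mult_left_mono mult_nonneg_nonneg)
  moreover have "0 \<le> (real m + real j - real i) / (p - q)" "(real m + real j - real i) / (p - q) \<le> 2 * real m / (p - q)"
    using assms basic by (auto intro!: divide_nonneg_nonneg divide_right_mono)
  ultimately show "0 \<le> walk_time j i" "walk_time j i \<le> 2 * real m / (p - q) + walk_const"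
    unfolding walk_time_def by linarith+
qed

text \<open>
  The contribution of jumps to the right to the drift; it vanishes in the last gap, which has no
  neighbour on the right. By the supersolution property, jumps to the left contribute at most \<open>-1\<close>
  minus this term.
\<close>

definition walk_right :: "nat \<Rightarrow> nat \<Rightarrow> real" where
  "walk_right j i = (if i < m then p * (walk_time j (i + 1) - walk_time j i) else 0)"

lemma walk_time_drift:
  assumes "1 \<le> i" "i \<le> m" "i \<noteq> j" "j \<le> m"
  shows "q * (walk_time j (i - 1) - walk_time j i) \<le> - 1 - walk_right j i"
proof -
  obtain h where h: "i = Suc h" using assms by (cases i) auto
  have q: "q = lam * p" using basic by (simp add: lam_def)
  define D where "D = 1 / (p - q)"
  define X where "X = (real m + real j - real h) / (p - q)"
  have w: "walk_time j h = X + walk_const * (lam ^ j - lam ^ max h j)"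
    "walk_time j (Suc h) = X - D + walk_const * (lam ^ j - lam ^ max (Suc h) j)"
    "walk_time j (Suc (Suc h)) = X - 2 * D + walk_const * (lam ^ j - lam ^ max (Suc (Suc h)) j)"
    using basic by (auto simp: walk_time_def X_def D_def add_divide_distrib diff_divide_distrib)
  have "(p - q) * D = 1" using basic by (simp add: D_def)
  then have pq: "p * D - q * D = 1" by (simp add: left_diff_distrib)
  have pl: "p * lam = q" using basic by (simp add: lam_def)
  consider "i < j" | "j < i" "i < m" | "j < i" "i = m" using assms by linarith
  then show ?thesis
  proof cases
    case 1
    then have "max h j = j" "max (Suc h) j = j" "max (Suc (Suc h)) j = j" "Suc h < m" using assms h by auto
    then show ?thesis using pq by (simp add: walk_right_def h w algebra_simps)
  next
    case 2
    then have e: "max h j = h" "max (Suc h) j = Suc h" "max (Suc (Suc h)) j = Suc (Suc h)" using h by auto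
    have "p * lam ^ Suc (Suc h) + q * lam ^ h = lam ^ h * (p * lam * lam) + q * lam ^ h" by simp
    also have "\<dots> = lam ^ h * (q * lam + p * lam)" unfolding pl by (simp add: algebra_simps)
    also have "\<dots> = lam ^ Suc h" unfolding q_eq by (simp add: algebra_simps)
    finally have harm: "p * lam ^ Suc (Suc h) + q * lam ^ h = lam ^ Suc h" .
    have "q * (walk_time j h - walk_time j (Suc h)) + p * (walk_time j (Suc (Suc h)) - walk_time j (Suc h))
       = q * D - p * D - walk_const * (p * lam ^ Suc (Suc h) + q * lam ^ h - (p + q) * lam ^ Suc h)"
      unfolding w e by (simp add: algebra_simps)
    also have "\<dots> = - 1" unfolding harm using pq q_eq by simp
    finally show ?thesis using 2(2) by (simp add: walk_right_def h)
  next
    case 3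
    then have e: "max h j = h" "max (Suc h) j = Suc h" using h by auto
    have mh: "m = Suc h" using 3 h by simp
    have "q * lam ^ h = p * lam ^ Suc h" using pl by (metis mult.assoc power_Suc)
    then have "q * lam ^ h - q * lam ^ Suc h = lam ^ m * (p - q)"
      unfolding mh by (simp add: algebra_simps)
    moreover have "lam ^ m > 0" using basic by simp
    ultimately have c: "walk_const * (q * lam ^ h - q * lam ^ Suc h) = p * D"
      using basic by (simp add: walk_const_def power2_eq_square D_def)
    have "q * (walk_time j h - walk_time j (Suc h)) = q * D - walk_const * (q * lam ^ h - q * lam ^ Suc h)"
      unfolding w e by (simp add: algebra_simps)
    then have "q * (walk_time j h - walk_time j (Suc h)) = - 1" using pq unfolding c by simp
    then show ?thesis using mh by (simp add: walk_right_def h)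
  qed
qed

lemma walk_right_0:
  assumes "j \<noteq> 0" shows "walk_right j 0 \<le> - 1"
proof -
  have "max (Suc 0) j = j" using assms by auto
  then have "walk_right j 0 = - (p / (p - q))"
    using basic by (simp add: walk_right_def walk_time_def diff_divide_distrib right_diff_distrib add_divide_distrib)
  also have "\<dots> \<le> - 1" using basic by (simp add: field_simps)
  finally show ?thesis .
qed

text \<open>
  The contributions of jumps to the right telescope over clusters. What remains is
  \<open>-1\<close> for each cluster with a hole on its left and at most \<open>-1\<close> for a cluster at the left end.
  No cluster lies in the empty gap \<open>j\<close>.
\<close>

lemma trap_drift:
  assumes \<xi>: "\<xi> \<in> \<Omega>" "\<xi> \<notin> \<E>" and j: "j \<in> traps \<xi>"
  shows "L (particle_sum N (walk_time j)) \<xi> \<le> - 1"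
proof -
  define a where "a x = walk_right j (holes_before \<xi> x)" for x
  have jm: "j \<le> m" using j by (simp add: traps_def)
  have r: "p * (walk_time j (holes_before \<xi> x + 1) - walk_time j (holes_before \<xi> x)) = a x"
    if "x \<in> right_jumps N \<xi>" for x
    using right_jump_holes[OF \<xi>(1) that] by (simp add: a_def walk_right_def)
  have l: "q * (walk_time j (holes_before \<xi> x - 1) - walk_time j (holes_before \<xi> x)) \<le> - 1 - a x"
    if "x \<in> left_jumps N \<xi>" for x
    unfolding a_def
  proof (rule walk_time_drift)
    show "1 \<le> holes_before \<xi> x" by (rule left_jump_holes[OF that])
    show "holes_before \<xi> x \<le> m" "holes_before \<xi> x \<noteq> j"
      using holes_before_le[OF \<xi>(1), of x] that j by (auto simp: left_jumps_def traps_def)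
  qed (rule jm)
  have "L (particle_sum N (walk_time j)) \<xi> \<le> (\<Sum>x\<in>right_jumps N \<xi>. a x) + (\<Sum>x\<in>left_jumps N \<xi>. - 1 - a x)"
    unfolding generator_particle_sum[OF \<xi>(1)] by (intro add_mono sum_mono) (use r l in auto)
  also have "\<dots> = - real (card (left_jumps N \<xi>)) - ((\<Sum>x\<in>left_jumps N \<xi>. a x) - (\<Sum>x\<in>right_jumps N \<xi>. a x))"
    by (simp add: sum_subtractf)
  also have "(\<Sum>x\<in>left_jumps N \<xi>. a x) - (\<Sum>x\<in>right_jumps N \<xi>. a x)
      = a (N - 1) * of_bool (pair_at \<xi> (N - 1)) - a 1 * of_bool (pair_at \<xi> 1) - (1 - 1) * (\<Sum>x=1..N - 2. a x * of_bool (pair_at \<xi> x))"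
    by (rule jump_balance[OF \<xi>(1)]) (use basic in \<open>auto simp: a_def pair_at_def\<close>)
  also have "\<dots> = - (walk_right j 0 * of_bool (pair_at \<xi> 1))"
    using holes_before_last_pair[OF \<xi>(1)] by (auto simp: a_def walk_right_def)
  finally have drift: "L (particle_sum N (walk_time j)) \<xi>
      \<le> - real (card (left_jumps N \<xi>)) + walk_right j 0 * of_bool (pair_at \<xi> 1)" by simp
  show ?thesis
  proof (cases "pair_at \<xi> 1")
    case True
    then have "j \<noteq> 0" using j basic by (force simp: traps_def pair_at_def)
    then show ?thesis using drift True walk_right_0[of j] by simp
  next
    case False
    define x where "x = (LEAST x. x \<in> {1..N - 1} \<and> pair_at \<xi> x)"
    have x: "x \<in> {1..N - 1}" "pair_at \<xi> x"
      using LeastI_ex[of "\<lambda>x. x \<in> {1..N - 1} \<and> pair_at \<xi> x"] exists_pair[OF \<xi>] unfolding x_def by blast+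
    have "x \<noteq> 1" using False x by auto
    then have x2: "2 \<le> x" using x by auto
    then have "\<not> pair_at \<xi> (x - 1)"
      using not_less_Least[of "x - 1" "\<lambda>x. x \<in> {1..N - 1} \<and> pair_at \<xi> x"] x unfolding x_def[symmetric] by auto
    then have "\<xi> (x - 1) = 0" using zero_or_one[OF \<xi>(1), of "x - 1"] x x2 by (auto simp: pair_at_def)
    then have "x \<in> left_jumps N \<xi>" using x x2 by (auto simp: left_jumps_def pair_at_def)
    then have "1 \<le> card (left_jumps N \<xi>)" by (metis One_nat_def Suc_leI card_gt_0_iff empty_iff finite_jumps(2))
    then show ?thesis using drift False by simp
  qed
qed

text \<open>
  Filling a gap saves \<open>trap_cost\<close>, which dominates every value of the particle sum; hence the potential
  does not increase when the target gap gets filled and the next empty gap takes over.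
\<close>

definition trap_cost :: real where
  "trap_cost = real N * (2 * real m / (p - q) + walk_const)"

definition trap_potential :: "config \<Rightarrow> real" where
  "trap_potential \<xi> = (if \<xi> \<in> \<E> then 0
     else trap_cost * real (card (traps \<xi>)) + particle_sum N (walk_time (Min (traps \<xi>))) \<xi>)"

lemma trap_cost_nonneg: "0 \<le> trap_cost"
  using basic walk_const_pos by (auto simp: trap_cost_def)

lemma finite_traps [simp]: "finite (traps \<xi>)" and card_traps: "card (traps \<xi>) \<le> m + 1"
proof -
  have "traps \<xi> \<subseteq> {0..m}" by (auto simp: traps_def)
  then show "finite (traps \<xi>)" "card (traps \<xi>) \<le> m + 1"
    using finite_subset card_mono[of "{0..m}" "traps \<xi>"] by auto
qed

lemma walk_sum_bounds:
  assumes \<xi>: "\<xi> \<in> \<Omega>" and j: "j \<le> m"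
  shows "0 \<le> particle_sum N (walk_time j) \<xi>" "particle_sum N (walk_time j) \<xi> \<le> trap_cost"
proof -
  have H: "holes_before \<xi> x \<le> m" if "x \<in> {x \<in> {1..N}. \<xi> x = 1}" for x
    using that by (intro holes_before_le[OF \<xi>]) auto
  show "0 \<le> particle_sum N (walk_time j) \<xi>"
    unfolding particle_sum_def by (intro sum_nonneg walk_time_bounds(1) H j)
  have "particle_sum N (walk_time j) \<xi>
      \<le> real (card {x \<in> {1..N}. \<xi> x = 1}) * (2 * real m / (p - q) + walk_const)"
    unfolding particle_sum_def by (intro sum_bounded_above walk_time_bounds(2) H j)
  also have "\<dots> \<le> trap_cost"
  proof -
    have "card {x \<in> {1..N}. \<xi> x = 1} \<le> card {1..N}" by (intro card_mono) auto
    then show ?thesis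
      unfolding trap_cost_def using basic walk_const_pos by (intro mult_right_mono) auto
  qed
  finally show "particle_sum N (walk_time j) \<xi> \<le> trap_cost" .
qed

lemma Min_traps:
  assumes "\<xi> \<in> \<Omega>" "\<xi> \<notin> \<E>" shows "Min (traps \<xi>) \<in> traps \<xi>" "Min (traps \<xi>) \<le> m"
proof -
  show "Min (traps \<xi>) \<in> traps \<xi>" using traps_nonempty[OF assms] by simp
  then show "Min (traps \<xi>) \<le> m" by (simp add: traps_def)
qed

lemma trap_potential_bounds:
  assumes "\<xi> \<in> \<Omega>"
  shows "0 \<le> trap_potential \<xi>" "trap_potential \<xi> \<le> trap_cost * (real m + 2)"
proof -
  have "trap_cost * real (card (traps \<xi>)) \<le> trap_cost * (real m + 1)"
    using card_traps[of \<xi>] trap_cost_nonneg by (intro mult_left_mono) auto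
  moreover have "0 \<le> trap_cost * real (card (traps \<xi>))" "0 \<le> trap_cost * (real m + 2)"
    using trap_cost_nonneg by auto
  moreover have "0 \<le> particle_sum N (walk_time (Min (traps \<xi>))) \<xi>"
    "particle_sum N (walk_time (Min (traps \<xi>))) \<xi> \<le> trap_cost" if "\<xi> \<notin> \<E>"
    using walk_sum_bounds[OF assms Min_traps(2)[OF assms that]] .
  moreover have "trap_cost * (real m + 2) = trap_cost * (real m + 1) + trap_cost" by (simp add: algebra_simps)
  ultimately show "0 \<le> trap_potential \<xi>" "trap_potential \<xi> \<le> trap_cost * (real m + 2)"
    unfolding trap_potential_def by (smt (verit))+
qed

lemma trap_potential_jump:
  assumes \<xi>: "\<xi> \<in> \<Omega>" "\<xi> \<notin> \<E>" and \<eta>: "\<eta> \<in> \<Omega>" and sub: "traps \<eta> \<subseteq> traps \<xi>"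
  shows "trap_potential \<eta> \<le> trap_cost * real (card (traps \<xi>)) + particle_sum N (walk_time (Min (traps \<xi>))) \<eta>"
proof (cases "\<eta> \<in> \<E>")
  case True
  then show ?thesis
    using walk_sum_bounds(1)[OF \<eta> Min_traps(2)[OF \<xi>]] trap_cost_nonneg by (simp add: trap_potential_def)
next
  case False
  note M = Min_traps[OF \<eta> False]
  show ?thesis
  proof (cases "Min (traps \<xi>) \<in> traps \<eta>")
    case True
    then have "Min (traps \<eta>) = Min (traps \<xi>)"
      using sub M by (intro Min_eqI) auto
    moreover have "trap_cost * real (card (traps \<eta>)) \<le> trap_cost * real (card (traps \<xi>))"
      using trap_cost_nonneg card_mono[OF _ sub] by (intro mult_left_mono) auto
    ultimately show ?thesis using False by (simp add: trap_potential_def)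
  next
    case nin: False
    then have "traps \<eta> \<subset> traps \<xi>" using sub Min_traps(1)[OF \<xi>] by blast
    then have "card (traps \<eta>) < card (traps \<xi>)" by (intro psubset_card_mono) auto
    then have "real (card (traps \<eta>)) + 1 \<le> real (card (traps \<xi>))" by linarith
    then have "trap_cost * (real (card (traps \<eta>)) + 1) \<le> trap_cost * real (card (traps \<xi>))"
      using trap_cost_nonneg by (intro mult_left_mono) auto
    then show ?thesis
      using walk_sum_bounds(2)[OF \<eta> M(2)] walk_sum_bounds(1)[OF \<eta> Min_traps(2)[OF \<xi>]] False
      by (simp add: trap_potential_def algebra_simps)
  qed
qed

lemma ergodic_adjacent:
  assumes "\<xi> \<in> \<E>" "1 \<le> x" "Suc x \<le> N" "\<xi> x = 0" shows "\<xi> (Suc x) = 1"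
proof -
  have "x \<in> {1..N - 1}" using assms(2,3) by simp
  then have "\<xi> x + \<xi> (x + 1) \<ge> 1" using assms(1) unfolding fep_ergodic_def by blast
  then show ?thesis using zero_or_one[OF ergodic_config[OF assms(1)], of "Suc x"] assms by auto
qed

lemma ergodic_ends: "\<xi> \<in> \<E> \<Longrightarrow> \<xi> 1 = 1" "\<xi> \<in> \<E> \<Longrightarrow> \<xi> N = 1"
  by (auto simp: fep_ergodic_def)

lemma ergodicI:
  assumes "\<xi> \<in> \<Omega>" "\<And>x. 1 \<le> x \<Longrightarrow> Suc x \<le> N \<Longrightarrow> \<xi> x = 0 \<Longrightarrow> \<xi> (Suc x) = 0 \<Longrightarrow> False" "\<xi> 1 = 1" "\<xi> N = 1"
  shows "\<xi> \<in> \<E>"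
proof -
  have "1 \<le> \<xi> x + \<xi> (x + 1)" if "x \<in> {1..N - 1}" for x
  proof -
    have "1 \<le> x" "Suc x \<le> N" using that basic(7) unfolding atLeastAtMost_iff by linarith+
    then have "\<xi> x \<noteq> 0 \<or> \<xi> (Suc x) \<noteq> 0" using assms(2)[of x] by blast
    then show ?thesis by auto
  qed
  then show ?thesis using assms by (auto simp: fep_ergodic_def)
qed

lemma ergodic_right_jump:
  assumes "\<xi> \<in> \<E>" "x \<in> right_jumps N \<xi>"
  obtains y where "x = Suc y" "1 \<le> y" "y + 3 \<le> N" "\<xi> y = 1" "\<xi> (y + 1) = 1" "\<xi> (y + 2) = 0" "\<xi> (y + 3) = 1"
proof -
  obtain y where y: "x = Suc y" "1 \<le> y" "y + 2 \<le> N" "\<xi> y = 1" "\<xi> (Suc y) = 1" "\<xi> (Suc (Suc y)) = 0"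
    using assms(2) by (cases x) (auto simp: right_jumps_def)
  have "y + 2 \<noteq> N" using y ergodic_ends(2)[OF assms(1)] by (auto simp: numeral_2_eq_2)
  then have "y + 3 \<le> N" using y by simp
  moreover have "\<xi> (Suc (Suc (Suc y))) = 1"
    by (rule ergodic_adjacent[OF assms(1)]) (use y calculation in auto)
  ultimately show thesis using y that[of y] by (simp add: numeral_2_eq_2 numeral_3_eq_3)
qed

lemma ergodic_left_jump:
  assumes "\<xi> \<in> \<E>" "x \<in> left_jumps N \<xi>"
  obtains y where "x = y + 2" "1 \<le> y" "y + 3 \<le> N" "\<xi> y = 1" "\<xi> (y + 1) = 0" "\<xi> (y + 2) = 1" "\<xi> (y + 3) = 1"
proof -
  have x: "2 \<le> x" "x \<le> N - 1" "\<xi> (x - 1) = 0" "\<xi> x = 1" "\<xi> (Suc x) = 1" using assms(2) by (auto simp: left_jumps_def)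
  have "x \<noteq> 2" using x ergodic_ends(1)[OF assms(1)] by auto
  then obtain y where y: "x = y + 2" "1 \<le> y" using x(1) le_Suc_ex[of 3 x] by fastforce
  have "\<xi> y = 1"
  proof (rule ccontr)
    assume "\<xi> y \<noteq> 1"
    then have "\<xi> y = 0" using zero_or_one[OF ergodic_config[OF assms(1)], of y] x y by auto
    then have "\<xi> (Suc y) = 1" by (intro ergodic_adjacent[OF assms(1)]) (use x y in auto)
    then show False using x y by simp
  qed
  then show thesis using x y that[of y] by (simp add: numeral_3_eq_3)
qed

lemma ergodic_closed:
  assumes "\<xi> \<in> \<E>"
  shows "x \<in> right_jumps N \<xi> \<Longrightarrow> swap \<xi> x \<in> \<E>" "x \<in> left_jumps N \<xi> \<Longrightarrow> swap \<xi> (x - 1) \<in> \<E>"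
proof -
  note adj = ergodic_adjacent[OF assms] and e = ergodic_ends[OF assms]
  assume x: "x \<in> right_jumps N \<xi>"
  from ergodic_right_jump[OF assms x] obtain y where
    y: "x = Suc y" "1 \<le> y" "y + 3 \<le> N" "\<xi> y = 1" "\<xi> (y + 1) = 1" "\<xi> (y + 2) = 0" "\<xi> (y + 3) = 1" .
  show "swap \<xi> x \<in> \<E>"
  proof (rule ergodicI)
    show "swap \<xi> x \<in> \<Omega>" by (rule right_jump_swap[OF ergodic_config[OF assms] x])
    fix z assume "1 \<le> z" "Suc z \<le> N" "swap \<xi> x z = 0" "swap \<xi> x (Suc z) = 0"
    then show False using y adj[of z]
      by (auto simp: swap_def numeral_2_eq_2 numeral_3_eq_3 split: if_splits)
  qed (use y e in \<open>auto simp: swap_def\<close>)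
next
  note adj = ergodic_adjacent[OF assms] and e = ergodic_ends[OF assms]
  assume x: "x \<in> left_jumps N \<xi>"
  from ergodic_left_jump[OF assms x] obtain y where
    y: "x = y + 2" "1 \<le> y" "y + 3 \<le> N" "\<xi> y = 1" "\<xi> (y + 1) = 0" "\<xi> (y + 2) = 1" "\<xi> (y + 3) = 1" .
  show "swap \<xi> (x - 1) \<in> \<E>"
  proof (rule ergodicI)
    show "swap \<xi> (x - 1) \<in> \<Omega>" by (rule left_jump_swap[OF ergodic_config[OF assms] x])
    fix z assume "1 \<le> z" "Suc z \<le> N" "swap \<xi> (x - 1) z = 0" "swap \<xi> (x - 1) (Suc z) = 0"
    then show False using y adj[of z]
      by (auto simp: swap_def numeral_2_eq_2 numeral_3_eq_3 split: if_splits)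
  qed (use y e in \<open>auto simp: swap_def\<close>)
qed

sublocale erg: markov_operator \<E> K
  by (rule markov_operator_K) (use ergodic_config ergodic_closed in auto)

lemma trap_potential_drift:
  assumes \<xi>: "\<xi> \<in> \<Omega>"
  shows "K trap_potential \<xi> \<le> trap_potential \<xi> - 1 / (2 * real N) * indicator (\<Omega> - \<E>) \<xi>"
proof (cases "\<xi> \<in> \<E>")
  case True
  then have "K trap_potential \<xi> = K (\<lambda>_. 0) \<xi>"
    by (intro erg.cong) (auto simp: trap_potential_def)
  then show ?thesis using erg.const[OF True, of 0] True by (simp add: trap_potential_def)
next
  case False
  define j where "j = Min (traps \<xi>)"
  define F where "F \<eta> = trap_cost * real (card (traps \<xi>)) + particle_sum N (walk_time j) \<eta>" for \<eta>
  have j: "j \<in> traps \<xi>" using Min_traps[OF \<xi> False] by (simp add: j_def)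
  have F\<xi>: "trap_potential \<xi> = F \<xi>" using False by (simp add: trap_potential_def F_def j_def)
  have le: "trap_potential (swap \<xi> x) \<le> F (swap \<xi> x)" if "x \<in> right_jumps N \<xi>" for x
    unfolding F_def j_def
    by (rule trap_potential_jump[OF \<xi> False right_jump_swap[OF \<xi> that] traps_jump(1)[OF \<xi> that]])
  have le': "trap_potential (swap \<xi> (x - 1)) \<le> F (swap \<xi> (x - 1))" if "x \<in> left_jumps N \<xi>" for x
    unfolding F_def j_def
    by (rule trap_potential_jump[OF \<xi> False left_jump_swap[OF \<xi> that] traps_jump(2)[OF \<xi> that]])
  have "K trap_potential \<xi> \<le> K F \<xi>"
    unfolding K_jumps[OF \<xi>] F\<xi>
    by (rule add_mono[OF add_mono[OF order_refl]]; rule mult_left_mono[OF sum_mono])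
       (use le le' basic in auto)
  also have "L F \<xi> = L (particle_sum N (walk_time j)) \<xi>"
    unfolding generator_jumps[OF \<xi>] by (simp add: F_def)
  then have "K F \<xi> = F \<xi> + L (particle_sum N (walk_time j)) \<xi> / (2 * real N)" by (simp add: K_def)
  also have "\<dots> \<le> F \<xi> + (- 1) / (2 * real N)"
    using trap_drift[OF \<xi> False j] by (intro add_left_mono divide_right_mono) auto
  finally show ?thesis using False \<xi> by (simp add: F\<xi>)
qed

lemma escape_to_ergodic:
  assumes "4 * real N * (trap_cost * (real m + 2)) \<le> real n" "1 \<le> n" "\<xi> \<in> \<Omega>"
  shows "(K ^^ n) (indicator (\<Omega> - \<E>)) \<xi> \<le> 1/2"
proof -
  have "real n * (1 / (2 * real N)) * (K ^^ n) (indicator (\<Omega> - \<E>)) \<xi> \<le> trap_potential \<xi>"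
  proof (rule chain.excursion_bound[OF trap_potential_bounds(1) trap_potential_drift _ _ assms(3)])
    fix \<eta> assume \<eta>: "\<eta> \<in> \<Omega>"
    show "K (indicator (\<Omega> - \<E>)) \<eta> \<le> indicator (\<Omega> - \<E>) \<eta>"
    proof (cases "\<eta> \<in> \<E>")
      case True
      then have "K (indicator (\<Omega> - \<E>)) \<eta> = K (\<lambda>_. 0) \<eta>" by (intro erg.cong) auto
      then show ?thesis using erg.const[OF True] True by simp
    next
      case False
      have "K (indicator (\<Omega> - \<E>)) \<eta> \<le> K (\<lambda>_. 1) \<eta>"
        by (rule chain.mono[OF _ \<eta>]) (auto simp: indicator_def)
      then show ?thesis using chain.const[OF \<eta>] False \<eta> by simp
    qed
  qed auto
  then have "real n * (1 / (2 * real N)) * (K ^^ n) (indicator (\<Omega> - \<E>)) \<xi> \<le> trap_cost * (real m + 2)"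
    using trap_potential_bounds(2)[OF assms(3)] by linarith
  then have "real n * (K ^^ n) (indicator (\<Omega> - \<E>)) \<xi> \<le> 2 * real N * (trap_cost * (real m + 2))"
    using basic by (simp add: field_simps)
  also have "\<dots> \<le> real n * (1/2)" using assms(1) by simp
  finally show ?thesis using assms(2) by (simp add: mult_le_cancel_left)
qed

section \<open>Relaxation inside the ergodic component\<close>

definition excess_potential :: "real \<Rightarrow> config \<Rightarrow> real" where
  "excess_potential v = pair_sum N (\<lambda>R H. v ^ R * (v ^ (m - H) - 1))"

text \<open>
  A jump to the right at \<open>x\<close> changes the potential by \<open>- w x * (v - 1) / v\<^sup>2\<close> and one to the left by
  \<open>w x * (v - 1)\<close>, where \<open>w x = v ^ (m - H) * v ^ R\<close>. As \<open>q * v\<^sup>2 \<le> p\<close>, the drift is at most a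
  constant times the difference of the sums of \<open>w\<close> over left and right jumps. Inside a
  cluster \<open>w\<close> grows by the factor \<open>v\<close>, so the difference telescopes to a sum over all pairs in which
  the contribution of the last gap, where \<open>w x = v ^ R\<close>, cancels against the boundary term up to the
  constant \<open>1\<close>.
\<close>

lemma excess_drift:
  assumes \<xi>: "\<xi> \<in> \<E>" and v: "1 < v" "q * v\<^sup>2 \<le> p"
  shows "L (excess_potential v) \<xi> \<le> p * (v - 1) / v\<^sup>2 * (1 - (v - 1) * excess_potential v \<xi>)"
proof -
  note \<xi>' = ergodic_config[OF \<xi>]
  define w where "w x = v ^ (m - holes_before \<xi> x) * v ^ pairs_before \<xi> x" for x
  \<comment> \<open>Left and right jumps are compared with the common factor \<open>c\<close>, exact for right jumps.\<close>
  define c where "c = p * (v - 1) / v\<^sup>2"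
  define b where "b x = (of_bool (pair_at \<xi> x) :: real)" for x
  have w0: "0 \<le> w x" for x using v by (simp add: w_def)
  have "p * (excess_potential v (swap \<xi> x) - excess_potential v \<xi>) = - c * w x"
    if x: "x \<in> right_jumps N \<xi>" for x
  proof -
    from ergodic_right_jump[OF \<xi> x] obtain y where
      y: "x = Suc y" "1 \<le> y" "y + 3 \<le> N" "\<xi> y = 1" "\<xi> (y + 1) = 1" "\<xi> (y + 2) = 0" "\<xi> (y + 3) = 1" .
    have "holes_before \<xi> y < m" using right_jump_holes[OF \<xi>' x] y by simp
    then obtain h where h: "m - holes_before \<xi> y = Suc h" by (cases "m - holes_before \<xi> y") auto
    have h': "m - (holes_before \<xi> y + 1) = h" using h by simp
    have "pair_at \<xi> y" using y by (simp add: pair_at_def)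
    then have w: "w x = v ^ Suc h * (v ^ pairs_before \<xi> y * v)" using y h by (simp add: w_def)
    have "excess_potential v (swap \<xi> x) - excess_potential v \<xi>
        = v ^ pairs_before \<xi> y * (v ^ h - 1) - v ^ pairs_before \<xi> y * (v ^ Suc h - 1)"
      unfolding excess_potential_def y(1) pair_sum_swap[OF y(2-)] h h' by simp
    also have "\<dots> = - (v - 1) * (v ^ pairs_before \<xi> y * v ^ h)" by (simp add: algebra_simps)
    finally have d: "excess_potential v (swap \<xi> x) - excess_potential v \<xi>
        = - (v - 1) * (v ^ pairs_before \<xi> y * v ^ h)" .
    have "p * (excess_potential v (swap \<xi> x) - excess_potential v \<xi>)
        = - (p * (v - 1) * (v ^ pairs_before \<xi> y * v ^ h))" unfolding d by (simp add: algebra_simps)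
    also have "p * (v - 1) * (v ^ pairs_before \<xi> y * v ^ h) = c * w x"
      using v by (simp add: w c_def power2_eq_square)
    finally show ?thesis by simp
  qed
  moreover have "q * (excess_potential v (swap \<xi> (x - 1)) - excess_potential v \<xi>) \<le> c * w x"
    if x: "x \<in> left_jumps N \<xi>" for x
  proof -
    from ergodic_left_jump[OF \<xi> x] obtain y where
      y: "x = y + 2" "1 \<le> y" "y + 3 \<le> N" "\<xi> y = 1" "\<xi> (y + 1) = 0" "\<xi> (y + 2) = 1" "\<xi> (y + 3) = 1" .
    have np: "\<not> pair_at \<xi> y" "\<not> pair_at \<xi> (Suc y)" using y by (auto simp: pair_at_def)
    have e: "holes_before \<xi> x = holes_before \<xi> y + 1" "pairs_before \<xi> x = pairs_before \<xi> y"
      using y np by (auto simp: numeral_2_eq_2)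
    have "holes_before \<xi> x \<le> m" using y by (intro holes_before_le[OF \<xi>']) auto
    then obtain h where h: "m - holes_before \<xi> y = Suc h" using e by (cases "m - holes_before \<xi> y") auto
    have h': "m - (holes_before \<xi> y + 1) = h" using h by simp
    have x1: "x - 1 = Suc y" using y by simp
    have "excess_potential v (swap \<xi> (x - 1)) - excess_potential v \<xi>
        = v ^ pairs_before \<xi> y * (v ^ Suc h - 1) - v ^ pairs_before \<xi> y * (v ^ h - 1)"
      unfolding excess_potential_def x1 pair_sum_swap_left[OF y(2-)] h h' by simp
    also have "\<dots> = (v - 1) * w x" unfolding w_def e h' by (simp add: algebra_simps)
    finally have "q * (excess_potential v (swap \<xi> (x - 1)) - excess_potential v \<xi>) = q * (v - 1) * w x" by simp
    also have "q \<le> p / v\<^sup>2" using v by (simp add: pos_le_divide_eq)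
    then have "q * (v - 1) \<le> p / v\<^sup>2 * (v - 1)" using v by (intro mult_right_mono) auto
    then have "q * (v - 1) \<le> c" by (simp add: c_def)
    then have "q * (v - 1) * w x \<le> c * w x" by (rule mult_right_mono[OF _ w0])
    finally show ?thesis .
  qed
  ultimately have "L (excess_potential v) \<xi> \<le> (\<Sum>x\<in>right_jumps N \<xi>. - c * w x) + (\<Sum>x\<in>left_jumps N \<xi>. c * w x)"
    unfolding generator_jumps[OF \<xi>'] sum_distrib_left by (intro add_mono sum_mono) auto
  also have "\<dots> = c * ((\<Sum>x\<in>left_jumps N \<xi>. w x) - (\<Sum>x\<in>right_jumps N \<xi>. w x))"
    unfolding sum_distrib_left[symmetric] by (simp add: algebra_simps)
  also have "\<dots> \<le> c * (1 - (v - 1) * excess_potential v \<xi>)"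
  proof (rule mult_left_mono)
    show "0 \<le> c" using v basic by (simp add: c_def)
    have "(\<Sum>x\<in>left_jumps N \<xi>. w x) - (\<Sum>x\<in>right_jumps N \<xi>. w x)
      = w (N - 1) * b (N - 1) - w 1 * b 1 - (v - 1) * (\<Sum>x=1..N - 2. w x * b x)"
      unfolding b_def by (rule jump_balance[OF \<xi>']) (use basic in \<open>auto simp: w_def pair_at_def\<close>)
    also have "\<dots> \<le> v ^ pairs_before \<xi> (N - 1) - (v - 1) * (\<Sum>x=1..N - 2. w x * b x)"
    proof -
      have "w (N - 1) * b (N - 1) \<le> v ^ pairs_before \<xi> (N - 1)"
        using holes_before_last_pair[OF \<xi>'] v by (auto simp: w_def b_def)
      moreover have "0 \<le> w 1 * b 1" using w0 by (simp add: b_def)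
      ultimately show ?thesis by linarith
    qed
    also have "v ^ pairs_before \<xi> (N - 1) = 1 + (v - 1) * (\<Sum>x=1..N - 2. v ^ pairs_before \<xi> x * b x)"
    proof -
      have "v ^ pairs_before \<xi> (Suc n) = 1 + (v - 1) * (\<Sum>x=1..n. v ^ pairs_before \<xi> x * b x)" for n
        by (induction n) (auto simp: b_def algebra_simps)
      moreover have "Suc (N - 2) = N - 1" using basic by simp
      ultimately show ?thesis by metis
    qed
    also have "(\<Sum>x=1..N - 2. w x * b x) = excess_potential v \<xi> + (\<Sum>x=1..N - 2. v ^ pairs_before \<xi> x * b x)"
    proof -
      have "excess_potential v \<xi> = (\<Sum>x=1..<N. v ^ pairs_before \<xi> x * (v ^ (m - holes_before \<xi> x) - 1) * b x)"
        unfolding excess_potential_def pair_sum_def sum.inter_filter[OF finite_atLeastLessThan]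
        by (intro sum.cong) (auto simp: b_def)
      also have "{1..<N} = insert (N - 1) {1..N - 2}" using basic by auto
      also have "(\<Sum>x\<in>insert (N - 1) {1..N - 2}. v ^ pairs_before \<xi> x * (v ^ (m - holes_before \<xi> x) - 1) * b x)
         = (\<Sum>x=1..N - 2. v ^ pairs_before \<xi> x * (v ^ (m - holes_before \<xi> x) - 1) * b x)"
        using basic holes_before_last_pair[OF \<xi>'] by (subst sum.insert) (auto simp: b_def)
      finally show ?thesis by (simp add: w_def algebra_simps flip: sum.distrib)
    qed
    finally show "(\<Sum>x\<in>left_jumps N \<xi>. w x) - (\<Sum>x\<in>right_jumps N \<xi>. w x)
        \<le> 1 - (v - 1) * excess_potential v \<xi>" by (simp add: algebra_simps)
  qed
  finally show ?thesis by (simp add: c_def)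
qed

text \<open>
  All pairs are in the last gap: the configuration is \<open>1010\<dots>10\<close> followed by particles only.
\<close>

definition ground :: "config set" where
  "ground = {\<xi> \<in> \<E>. \<forall>x\<in>{1..<N}. pair_at \<xi> x \<longrightarrow> holes_before \<xi> x = m}"

lemma ground_unique:
  assumes \<xi>: "\<xi> \<in> ground" and \<eta>: "\<eta> \<in> ground" shows "\<xi> = \<eta>"
proof -
  have next_site: "\<zeta> (Suc x) = (if \<zeta> x = 0 then 1 else if holes_before \<zeta> x = m then 1 else 0)"
    if \<zeta>: "\<zeta> \<in> ground" and x: "1 \<le> x" "Suc x \<le> N" for \<zeta> x
  proof -
    have \<zeta>': "\<zeta> \<in> \<E>" "\<zeta> \<in> \<Omega>" using \<zeta> ergodic_config by (auto simp: ground_def)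
    note v = zero_or_one[OF \<zeta>'(2)]
    consider "\<zeta> x = 0" | "\<zeta> x = 1" "holes_before \<zeta> x = m" | "\<zeta> x = 1" "holes_before \<zeta> x \<noteq> m"
      using v[of x] x by auto
    then show ?thesis
    proof cases
      case 1
      then show ?thesis using ergodic_adjacent[OF \<zeta>'(1) x] by simp
    next
      case 2
      then have "\<zeta> (Suc x) \<noteq> 0" using holes_before_less[OF \<zeta>'(2), of x "Suc x"] x by auto
      then show ?thesis using v[of "Suc x"] x 2 by auto
    next
      case 3
      have "x \<in> {1..<N}" using x by auto
      then have "\<not> pair_at \<zeta> x" using \<zeta> 3 unfolding ground_def by blast
      then show ?thesis using v[of "Suc x"] x 3 by (auto simp: pair_at_def)
    qed
  qed
  have "1 \<le> x \<Longrightarrow> x \<le> N \<Longrightarrow> \<xi> x = \<eta> x \<and> holes_before \<xi> x = holes_before \<eta> x" for x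
  proof (induction x)
    case (Suc x)
    show ?case
    proof (cases "x = 0")
      case True
      then show ?thesis using \<xi> \<eta> ergodic_ends(1)[of \<xi>] ergodic_ends(1)[of \<eta>] by (auto simp: ground_def)
    next
      case False
      then have "\<xi> x = \<eta> x \<and> holes_before \<xi> x = holes_before \<eta> x" using Suc by auto
      then show ?thesis using next_site[OF \<xi>, of x] next_site[OF \<eta>, of x] False Suc.prems by simp
    qed
  qed simp
  moreover have "\<xi> \<in> extensional {1..N}" "\<eta> \<in> extensional {1..N}"
    using \<xi> \<eta> by (auto simp: ground_def fep_ergodic_def fep_configs_def PiE_iff)
  ultimately show ?thesis by (intro extensionalityI[of _ "{1..N}"]) auto
qed

text \<open>
  The number of jumps to the right that lead to the ground state.
\<close>

definition excess_dist :: "config \<Rightarrow> real" where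
  "excess_dist = pair_sum N (\<lambda>R H. real (m - H))"

lemma excess_dist_nonneg: "0 \<le> excess_dist \<xi>"
  unfolding excess_dist_def pair_sum_def by (intro sum_nonneg) auto

lemma excess_dist_le:
  assumes "1 < v" shows "(v - 1) * excess_dist \<xi> \<le> excess_potential v \<xi>"
  unfolding excess_dist_def excess_potential_def pair_sum_def sum_distrib_left
proof (rule sum_mono)
  fix x
  define n where "n = m - holes_before \<xi> x"
  have "(v - 1) * real n \<le> v ^ n - 1"
    using Bernoulli_inequality[of "v - 1" n] assms by (simp add: mult.commute)
  also have "\<dots> \<le> v ^ pairs_before \<xi> x * (v ^ n - 1)"
  proof -
    have "1 * (v ^ n - 1) \<le> v ^ pairs_before \<xi> x * (v ^ n - 1)"
      using assms by (intro mult_right_mono) auto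
    then show ?thesis by simp
  qed
  finally show "(v - 1) * real (m - holes_before \<xi> x)
      \<le> v ^ pairs_before \<xi> x * (v ^ (m - holes_before \<xi> x) - 1)" by (simp add: n_def)
qed

text \<open>
  The last pair outside gap \<open>m\<close> is followed by a hole, since otherwise the next pair would lie in the
  same gap.
\<close>

lemma descent_step:
  assumes \<xi>: "\<xi> \<in> \<E>" "\<xi> \<notin> ground"
  shows "\<exists>x\<in>right_jumps N \<xi>. excess_dist (swap \<xi> x) = excess_dist \<xi> - 1"
proof -
  note \<xi>' = ergodic_config[OF \<xi>(1)]
  define P where "P = {x \<in> {1..<N}. pair_at \<xi> x \<and> holes_before \<xi> x \<noteq> m}"
  have "finite P" "P \<noteq> {}" using \<xi> by (auto simp: P_def ground_def)
  define x where "x = Max P"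
  have x: "x \<in> P" "Suc x \<notin> P"
    using Max_in[OF \<open>finite P\<close> \<open>P \<noteq> {}\<close>] Max_ge[OF \<open>finite P\<close>, of "Suc x"] by (auto simp: x_def)
  have xp: "1 \<le> x" "x < N" "\<xi> x = 1" "\<xi> (Suc x) = 1" "holes_before \<xi> x \<noteq> m"
    using x by (auto simp: P_def pair_at_def)
  then have hx: "holes_before \<xi> (Suc x) = holes_before \<xi> x" by simp
  have "Suc x \<noteq> N"
  proof
    assume "Suc x = N"
    then have "holes_before \<xi> (N - 1) = m"
      by (intro holes_before_last_pair[OF \<xi>']) (use xp in \<open>auto simp: pair_at_def\<close>)
    then show False using xp \<open>Suc x = N\<close> by auto
  qed
  then have "Suc x < N" using xp by simp
  then have "\<not> pair_at \<xi> (Suc x)" using x(2) xp hx by (auto simp: P_def)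
  then have "\<xi> (Suc (Suc x)) = 0"
    using zero_or_one[OF \<xi>', of "Suc (Suc x)"] xp \<open>Suc x < N\<close> by (auto simp: pair_at_def)
  then have j: "Suc x \<in> right_jumps N \<xi>" using xp \<open>Suc x < N\<close> by (auto simp: right_jumps_def)
  from ergodic_right_jump[OF \<xi>(1) j] obtain y where
    y: "Suc x = Suc y" "1 \<le> y" "y + 3 \<le> N" "\<xi> y = 1" "\<xi> (y + 1) = 1" "\<xi> (y + 2) = 0" "\<xi> (y + 3) = 1" .
  have "x = y" using y(1) by simp
  moreover have "holes_before \<xi> x < m" using right_jump_holes[OF \<xi>' j] unfolding hx .
  ultimately have "holes_before \<xi> y < m" by simp
  then have "excess_dist (swap \<xi> (Suc y)) = excess_dist \<xi> - 1"
    unfolding excess_dist_def pair_sum_swap[OF y(2-)] by (simp add: of_nat_diff)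
  then show ?thesis using j y(1) by auto
qed

lemma K_lower:
  assumes \<xi>: "\<xi> \<in> \<E>" and f: "\<And>\<eta>. \<eta> \<in> \<E> \<Longrightarrow> 0 \<le> f \<eta>"
  shows "p / (2 * real N) * f \<xi> \<le> K f \<xi>"
    and "x \<in> right_jumps N \<xi> \<Longrightarrow> p / (2 * real N) * f (swap \<xi> x) \<le> K f \<xi>"
proof -
  note \<xi>' = ergodic_config[OF \<xi>]
  define a b where "a = (\<Sum>x\<in>right_jumps N \<xi>. f (swap \<xi> x))"
    and "b = (\<Sum>x\<in>left_jumps N \<xi>. f (swap \<xi> (x - 1)))"
  have ab: "0 \<le> p / (2 * real N) * a" "0 \<le> q / (2 * real N) * b"
    unfolding a_def b_def using basic ergodic_closed[OF \<xi>] f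
    by (intro mult_nonneg_nonneg divide_nonneg_nonneg sum_nonneg; auto)+
  have K: "K f \<xi> = stay \<xi> * f \<xi> + p / (2 * real N) * a + q / (2 * real N) * b"
    unfolding K_jumps[OF \<xi>'] a_def b_def by simp
  have "p / (2 * real N) \<le> 1/2" using basic p_lt by (simp add: field_simps)
  then have "p / (2 * real N) * f \<xi> \<le> stay \<xi> * f \<xi>"
    using stay_ge[of \<xi>] f[OF \<xi>] by (intro mult_right_mono) auto
  then show "p / (2 * real N) * f \<xi> \<le> K f \<xi>" using ab K by linarith
  assume x: "x \<in> right_jumps N \<xi>"
  have "f (swap \<xi> x) \<le> a"
    unfolding a_def using ergodic_closed[OF \<xi>] f x by (intro member_le_sum) auto
  then have "p / (2 * real N) * f (swap \<xi> x) \<le> p / (2 * real N) * a"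
    using basic by (intro mult_left_mono) auto
  moreover have "0 \<le> stay \<xi> * f \<xi>" using stay_ge[of \<xi>] f[OF \<xi>] by auto
  ultimately show "p / (2 * real N) * f (swap \<xi> x) \<le> K f \<xi>" using ab K by linarith
qed

lemma reach_ground:
  assumes "\<xi> \<in> \<E>" "excess_dist \<xi> \<le> real n"
  shows "(p / (2 * real N)) ^ n \<le> (K ^^ n) (indicator ground) \<xi>"
  using assms
proof (induction n arbitrary: \<xi>)
  case 0
  have "\<xi> \<in> ground"
  proof (rule ccontr)
    assume "\<xi> \<notin> ground"
    then obtain x where "excess_dist (swap \<xi> x) = excess_dist \<xi> - 1" using descent_step 0 by blast
    then show False using excess_dist_nonneg[of "swap \<xi> x"] 0 by simp
  qed
  then show ?case by simp
next
  case (Suc n)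
  define f where "f = (K ^^ n) (indicator ground)"
  have f: "0 \<le> f \<eta>" if "\<eta> \<in> \<E>" for \<eta>
    unfolding f_def by (rule erg.positive_power[OF _ that]) auto
  have pos: "0 \<le> p / (2 * real N)" using basic by simp
  have Kn: "(K ^^ Suc n) (indicator ground) \<xi> = K f \<xi>" by (simp add: f_def)
  show ?case
  proof (cases "\<xi> \<in> ground")
    case True
    have "excess_dist \<xi> = 0"
      using True by (auto simp: excess_dist_def pair_sum_def ground_def)
    then have "(p / (2 * real N)) ^ n \<le> f \<xi>" unfolding f_def using Suc by (intro Suc.IH) auto
    then have "(p / (2 * real N)) ^ Suc n \<le> p / (2 * real N) * f \<xi>"
      unfolding power_Suc by (rule mult_left_mono[OF _ pos])
    also have "\<dots> \<le> K f \<xi>" by (rule K_lower(1)[OF Suc.prems(1) f])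
    finally show ?thesis unfolding Kn .
  next
    case False
    then obtain x where x: "x \<in> right_jumps N \<xi>" "excess_dist (swap \<xi> x) = excess_dist \<xi> - 1"
      using descent_step Suc by blast
    have "(p / (2 * real N)) ^ n \<le> f (swap \<xi> x)"
      unfolding f_def using Suc x ergodic_closed(1) by (intro Suc.IH) auto
    then have "(p / (2 * real N)) ^ Suc n \<le> p / (2 * real N) * f (swap \<xi> x)"
      unfolding power_Suc by (rule mult_left_mono[OF _ pos])
    also have "\<dots> \<le> K f \<xi>" by (rule K_lower(2)[OF Suc.prems(1) f x(1)])
    finally show ?thesis unfolding Kn .
  qed
qed

lemma excess_potential_bounds:
  assumes "1 < v"
  shows "0 \<le> excess_potential v \<xi>" "excess_potential v \<xi> \<le> real N * v ^ (2 * N)"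
proof -
  show "0 \<le> excess_potential v \<xi>"
    unfolding excess_potential_def pair_sum_def using assms by (intro sum_nonneg) auto
  have "v ^ pairs_before \<xi> x * (v ^ (m - holes_before \<xi> x) - 1) \<le> v ^ (2 * N)"
    if "x \<in> {x \<in> {1..<N}. pair_at \<xi> x}" for x
  proof -
    have "pairs_before \<xi> x \<le> card {1..<x}" unfolding pairs_before_def by (intro card_mono) auto
    also have "\<dots> \<le> N" using that by auto
    finally have "v ^ pairs_before \<xi> x \<le> v ^ N" using assms by (intro power_increasing) auto
    moreover have "v ^ (m - holes_before \<xi> x) - 1 \<le> v ^ N"
      using assms basic power_increasing[of "m - holes_before \<xi> x" N v] by linarith
    ultimately have "v ^ pairs_before \<xi> x * (v ^ (m - holes_before \<xi> x) - 1) \<le> v ^ N * v ^ N"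
      using assms by (intro mult_mono) auto
    then show ?thesis by (simp add: mult_2 power_add)
  qed
  then have "excess_potential v \<xi> \<le> real (card {x \<in> {1..<N}. pair_at \<xi> x}) * v ^ (2 * N)"
    unfolding excess_potential_def pair_sum_def by (intro sum_bounded_above) auto
  also have "\<dots> \<le> real N * v ^ (2 * N)"
  proof (rule mult_right_mono)
    have "card {x \<in> {1..<N}. pair_at \<xi> x} \<le> card {1..<N}" by (intro card_mono) auto
    then show "real (card {x \<in> {1..<N}. pair_at \<xi> x}) \<le> real N" by simp
  qed (use assms in auto)
  finally show "excess_potential v \<xi> \<le> real N * v ^ (2 * N)" .
qed

text \<open>
  The drift contracts the potential by \<open>1 - g / (2 * N)\<close> per step with a constant \<open>g\<close>, and the
  initial value is at most \<open>exp (N * (1 + 2 * ln v))\<close>.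
\<close>

lemma excess_relaxes:
  assumes v: "1 < v" "q * v\<^sup>2 \<le> p" and \<xi>: "\<xi> \<in> \<E>"
    and n: "2 * (real N)\<^sup>2 * (1 + 2 * ln v) * v\<^sup>2 / (p * (v - 1)\<^sup>2) \<le> real n"
  shows "(K ^^ n) (excess_potential v) \<xi> \<le> 1 + 1 / (v - 1)"
proof -
  define g where "g = p * (v - 1)\<^sup>2 / v\<^sup>2"
  define r where "r = g / (2 * real N)"
  have g: "0 < g" using v basic by (simp add: g_def)
  have r0: "0 < r" using g basic by (simp add: r_def)
  have "(v - 1)\<^sup>2 \<le> v\<^sup>2" using v by (intro power_mono) auto
  then have "g \<le> p" using v basic by (simp add: g_def field_simps mult_left_mono)
  then have r1: "r \<le> 1" using basic p_lt by (simp add: r_def field_simps)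
  have drift: "K (excess_potential v) \<eta> \<le> (1 - r) * excess_potential v \<eta> + r * (1 / (v - 1))"
    if "\<eta> \<in> \<E>" for \<eta>
  proof -
    have "K (excess_potential v) \<eta> \<le> excess_potential v \<eta>
        + (p * (v - 1) / v\<^sup>2 * (1 - (v - 1) * excess_potential v \<eta>)) / (2 * real N)"
      unfolding K_def using excess_drift[OF that v] by (intro add_left_mono divide_right_mono) auto
    also have "p * (v - 1) / v\<^sup>2 = g / (v - 1)" using v by (simp add: g_def power2_eq_square)
    also have "(g / (v - 1) * (1 - (v - 1) * excess_potential v \<eta>)) / (2 * real N)
        = r * (1 / (v - 1)) - r * excess_potential v \<eta>"
    proof -
      have "(g / d * (1 - d * e)) / (2 * real N) = r * (1 / d) - r * e" if "d \<noteq> 0" for d e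
        using that by (simp add: r_def right_diff_distrib diff_divide_distrib)
      then show ?thesis using v by simp
    qed
    finally show ?thesis by (simp add: algebra_simps)
  qed
  have b: "(K ^^ n) (excess_potential v) \<xi> \<le> (1 - r) ^ n * (excess_potential v \<xi> - 1 / (v - 1)) + 1 / (v - 1)"
    by (rule erg.contracting_bound[OF drift r1 \<xi>])
  have "(1 - r) ^ n * (excess_potential v \<xi> - 1 / (v - 1)) \<le> (1 - r) ^ n * excess_potential v \<xi>"
    using v r1 by (intro mult_left_mono) auto
  also have "\<dots> \<le> exp (- (r * n)) * (real N * v ^ (2 * N))"
  proof (rule mult_mono)
    have "(1 - r) ^ n \<le> exp (- r) ^ n" using r1 exp_ge_add_one_self[of "-r"] by (intro power_mono) auto
    then show "(1 - r) ^ n \<le> exp (- (r * n))" by (simp flip: exp_of_nat_mult add: mult.commute)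
  qed (use excess_potential_bounds[OF v(1)] in auto)
  also have "\<dots> \<le> exp (- (r * n)) * (exp (real N) * exp (2 * real N * ln v))"
  proof (intro mult_left_mono mult_mono)
    show "real N \<le> exp (real N)" using exp_ge_add_one_self[of "real N"] by linarith
    have "v ^ (2 * N) = exp (ln v) ^ (2 * N)" using v by simp
    also have "\<dots> = exp (2 * real N * ln v)" by (simp flip: exp_of_nat_mult)
    finally show "v ^ (2 * N) \<le> exp (2 * real N * ln v)" by simp
  qed (use v in auto)
  also have "\<dots> = exp (real N * (1 + 2 * ln v) - r * n)"
    by (simp flip: exp_add add: algebra_simps)
  also have "real N * (1 + 2 * ln v) \<le> r * n"
  proof -
    have "real N * (1 + 2 * ln v) = r * (2 * (real N)\<^sup>2 * (1 + 2 * ln v) * v\<^sup>2 / (p * (v - 1)\<^sup>2))"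
    proof -
      have "real N * X = (p * d / v\<^sup>2) / (2 * real N) * (2 * (real N)\<^sup>2 * X * v\<^sup>2 / (p * d))"
        if "d \<noteq> 0" for d X using that v basic by (simp add: power2_eq_square field_simps)
      then show ?thesis using v unfolding r_def g_def by simp
    qed
    also have "\<dots> \<le> r * n" using n r0 by (intro mult_left_mono) auto
    finally show ?thesis .
  qed
  then have "exp (real N * (1 + 2 * ln v) - r * n) \<le> 1" by simp
  finally show ?thesis using b by linarith
qed

text \<open>
  The three phases are: \<open>n1\<close> steps to become ergodic, \<open>n2\<close> steps to bring the mean of the excess
  potential down to a constant, and \<open>n3\<close> steps, a number that does not depend on \<open>N\<close>, straight to
  the ground state. Each of the first two succeeds with probability at least \<open>1/2\<close>.
\<close>

lemma ground_minorization:
  assumes v: "1 < v" "q * v\<^sup>2 \<le> p"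
    and n1: "4 * real N * (trap_cost * (real m + 2)) \<le> real n1" "1 \<le> n1"
    and n2: "2 * (real N)\<^sup>2 * (1 + 2 * ln v) * v\<^sup>2 / (p * (v - 1)\<^sup>2) \<le> real n2"
    and n3: "2 * (1 + 1 / (v - 1)) / (v - 1) \<le> real n3"
    and \<xi>: "\<xi> \<in> \<Omega>"
  shows "(p / (2 * real N)) ^ n3 / 4 \<le> (K ^^ (n1 + (n2 + n3))) (indicator ground) \<xi>"
proof -
  define a where "a = (p / (2 * real N)) ^ n3"
  define C where "C = 2 * (1 + 1 / (v - 1))"
  have a: "0 \<le> a" using basic by (simp add: a_def)
  have C: "0 < C" using v by (simp add: C_def add_pos_pos)
  have 1: "(- a / C) * excess_potential v \<eta> + a \<le> (K ^^ n3) (indicator ground) \<eta>" if \<eta>: "\<eta> \<in> \<E>" for \<eta>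
  proof (cases "excess_potential v \<eta> \<le> C")
    case True
    have "excess_dist \<eta> \<le> excess_potential v \<eta> / (v - 1)"
      using excess_dist_le[OF v(1), of \<eta>] v by (simp add: field_simps)
    also have "\<dots> \<le> C / (v - 1)" using True v by (intro divide_right_mono) auto
    also have "\<dots> \<le> real n3" using n3 by (simp add: C_def)
    finally have "a \<le> (K ^^ n3) (indicator ground) \<eta>" unfolding a_def by (rule reach_ground[OF \<eta>])
    moreover have "(- a / C) * excess_potential v \<eta> \<le> 0"
      using a C excess_potential_bounds(1)[OF v(1), of \<eta>] by simp
    ultimately show ?thesis by linarith
  next
    case False
    then have "1 \<le> excess_potential v \<eta> / C" using C by simp
    then have "a * 1 \<le> a * (excess_potential v \<eta> / C)" using a by (intro mult_left_mono)
    moreover have "0 \<le> (K ^^ n3) (indicator ground) \<eta>" by (rule erg.positive_power[OF _ \<eta>]) auto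
    ultimately show ?thesis by simp
  qed
  have 2: "a / 2 \<le> (K ^^ (n2 + n3)) (indicator ground) \<eta>" if \<eta>: "\<eta> \<in> \<E>" for \<eta>
  proof -
    have "(K ^^ n2) (excess_potential v) \<eta> \<le> C / 2"
      using excess_relaxes[OF v \<eta> n2] by (simp add: C_def)
    then have "(K ^^ n2) (excess_potential v) \<eta> / C \<le> 1 / 2"
      using C by (simp add: pos_divide_le_eq)
    then have "a * ((K ^^ n2) (excess_potential v) \<eta> / C) \<le> a * (1/2)" by (rule mult_left_mono[OF _ a])
    then have "a / 2 \<le> (- a / C) * (K ^^ n2) (excess_potential v) \<eta> + a" by simp
    also have "\<dots> = (K ^^ n2) (\<lambda>\<eta>. (- a / C) * excess_potential v \<eta> + a) \<eta>"
      by (rule erg.affine_power[OF \<eta>, symmetric])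
    also have "\<dots> \<le> (K ^^ n2) ((K ^^ n3) (indicator ground)) \<eta>" by (rule erg.mono_power[OF 1 \<eta>])
    finally show ?thesis by (simp add: funpow_add)
  qed
  have "(a / 2) * (1/2) \<le> (a / 2) * (1 - (K ^^ n1) (indicator (\<Omega> - \<E>)) \<xi>)"
    using escape_to_ergodic[OF n1 \<xi>] a by (intro mult_left_mono) auto
  also have "\<dots> = (K ^^ n1) (\<lambda>\<eta>. (- (a / 2)) * indicator (\<Omega> - \<E>) \<eta> + a / 2) \<xi>"
    unfolding chain.affine_power[OF \<xi>] by (simp add: algebra_simps)
  also have "\<dots> \<le> (K ^^ n1) ((K ^^ (n2 + n3)) (indicator ground)) \<xi>"
  proof (rule chain.mono_power[OF _ \<xi>])
    fix \<eta> assume \<eta>: "\<eta> \<in> \<Omega>"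
    have "0 \<le> (K ^^ (n2 + n3)) (indicator ground) \<eta>" by (rule chain.positive_power[OF _ \<eta>]) auto
    then show "- (a / 2) * indicator (\<Omega> - \<E>) \<eta> + a / 2 \<le> (K ^^ (n2 + n3)) (indicator ground) \<eta>"
      using 2[of \<eta>] \<eta> by (cases "\<eta> \<in> \<E>") auto
  qed
  finally show ?thesis by (simp add: a_def funpow_add)
qed

section \<open>Stationarity of the equilibrium\<close>

lemma hole_area_swap:
  assumes "1 \<le> x" "Suc x \<le> N" "\<xi> x = 1" "\<xi> (Suc x) = 0"
  shows "hole_area N \<xi> = Suc (hole_area N (swap \<xi> x))"
proof -
  define A where "A = {y \<in> {1..N}. \<xi> y = 0}"
  have "swap \<xi> x y = 0 \<longleftrightarrow> y = x \<or> (y \<noteq> Suc x \<and> \<xi> y = 0)" for y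
    using assms by (simp add: swap_def)
  then have "{y \<in> {1..N}. swap \<xi> x y = 0} = insert x (A - {Suc x})"
    using assms(1,2) by (auto simp: A_def)
  moreover have "x \<notin> A" "Suc x \<in> A" "finite A" using assms by (auto simp: A_def)
  ultimately have "hole_area N (swap \<xi> x) = x + \<Sum> (A - {Suc x})" by (simp add: hole_area_def)
  moreover have "\<Sum> A = Suc x + \<Sum> (A - {Suc x})"
    using \<open>Suc x \<in> A\<close> \<open>finite A\<close> by (rule sum.remove[rotated])
  ultimately show ?thesis by (simp add: hole_area_def A_def)
qed

text \<open>
  Detailed balance: the map that sends a configuration with a right jump at \<open>x\<close> to the configuration
  after the jump, with the inverse left jump at \<open>x + 1\<close>, is a bijection between the right and the
  left jumps available in ergodic configurations. The hole area drops by one, which turns the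
  rate \<open>p\<close> into \<open>q\<close>.
\<close>

lemma weight_invariant: "(\<Sum>\<xi>\<in>\<E>. lam ^ hole_area N \<xi> * L f \<xi>) = 0"
proof -
  define w where "w \<xi> = lam ^ hole_area N \<xi>" for \<xi>
  have fin: "finite \<E>" by (rule erg.finite_S)
  have R: "(\<Sum>\<xi>\<in>\<E>. \<Sum>x\<in>right_jumps N \<xi>. p * w \<xi> * (f (swap \<xi> x) - f \<xi>))
      = (\<Sum>(\<xi>, x)\<in>(SIGMA \<xi>:\<E>. right_jumps N \<xi>). p * w \<xi> * (f (swap \<xi> x) - f \<xi>))"
    by (rule sum.Sigma) (use fin in auto)
  have "(\<Sum>\<xi>\<in>\<E>. \<Sum>x\<in>left_jumps N \<xi>. q * w \<xi> * (f (swap \<xi> (x - 1)) - f \<xi>))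
      = (\<Sum>(\<xi>, x)\<in>(SIGMA \<xi>:\<E>. left_jumps N \<xi>). q * w \<xi> * (f (swap \<xi> (x - 1)) - f \<xi>))"
    by (rule sum.Sigma) (use fin in auto)
  also have "\<dots> = (\<Sum>(\<xi>, x)\<in>(SIGMA \<xi>:\<E>. right_jumps N \<xi>). - (p * w \<xi> * (f (swap \<xi> x) - f \<xi>)))"
  proof (rule sum.reindex_bij_witness[where
        i = "\<lambda>(\<xi>, x). (swap \<xi> x, Suc x)" and j = "\<lambda>(\<xi>, x). (swap \<xi> (x - 1), x - 1)"])
    fix c assume "c \<in> (SIGMA \<xi>:\<E>. left_jumps N \<xi>)"
    then obtain \<xi> x where c: "c = (\<xi>, x)" and \<xi>: "\<xi> \<in> \<E>" and x: "x \<in> left_jumps N \<xi>" by auto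
    from ergodic_left_jump[OF \<xi> x] obtain y where
      y: "x = y + 2" "1 \<le> y" "y + 3 \<le> N" "\<xi> y = 1" "\<xi> (y + 1) = 0" "\<xi> (y + 2) = 1" "\<xi> (y + 3) = 1" .
    show "(case case c of (\<xi>, x) \<Rightarrow> (swap \<xi> (x - 1), x - 1) of (\<xi>, x) \<Rightarrow> (swap \<xi> x, Suc x)) = c"
      using y by (simp add: c)
    show "(case c of (\<xi>, x) \<Rightarrow> (swap \<xi> (x - 1), x - 1)) \<in> (SIGMA \<xi>:\<E>. right_jumps N \<xi>)"
      using y ergodic_closed(2)[OF \<xi> x] by (auto simp: c right_jumps_def swap_def numeral_2_eq_2)
    have "hole_area N (swap \<xi> (Suc y)) = Suc (hole_area N \<xi>)"
    proof -
      have "swap \<xi> (Suc y) (Suc y) = 1" "swap \<xi> (Suc y) (Suc (Suc y)) = 0"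
        using y by (auto simp: swap_def numeral_2_eq_2)
      then show ?thesis using hole_area_swap[of "Suc y" "swap \<xi> (Suc y)"] y by simp
    qed
    moreover have "p * lam = q" using basic by (simp add: lam_def)
    ultimately have "p * w (swap \<xi> (Suc y)) = q * w \<xi>" by (simp add: w_def mult.assoc[symmetric])
    then have "- (p * w (swap \<xi> (Suc y)) * (f \<xi> - f (swap \<xi> (Suc y)))) = q * w \<xi> * (f (swap \<xi> (Suc y)) - f \<xi>)"
      by (metis minus_diff_eq mult_minus_right)
    then show "(case case c of (\<xi>, x) \<Rightarrow> (swap \<xi> (x - 1), x - 1) of
           (\<xi>, x) \<Rightarrow> - (p * w \<xi> * (f (swap \<xi> x) - f \<xi>)))
        = (case c of (\<xi>, x) \<Rightarrow> q * w \<xi> * (f (swap \<xi> (x - 1)) - f \<xi>))"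
      using y by (simp add: c)
  next
    fix c assume "c \<in> (SIGMA \<xi>:\<E>. right_jumps N \<xi>)"
    then obtain \<xi> x where c: "c = (\<xi>, x)" and \<xi>: "\<xi> \<in> \<E>" and x: "x \<in> right_jumps N \<xi>" by auto
    from ergodic_right_jump[OF \<xi> x] obtain y where
      y: "x = Suc y" "1 \<le> y" "y + 3 \<le> N" "\<xi> y = 1" "\<xi> (y + 1) = 1" "\<xi> (y + 2) = 0" "\<xi> (y + 3) = 1" .
    show "(case case c of (\<xi>, x) \<Rightarrow> (swap \<xi> x, Suc x) of (\<xi>, x) \<Rightarrow> (swap \<xi> (x - 1), x - 1)) = c"
      by (simp add: c)
    show "(case c of (\<xi>, x) \<Rightarrow> (swap \<xi> x, Suc x)) \<in> (SIGMA \<xi>:\<E>. left_jumps N \<xi>)"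
      using y ergodic_closed(1)[OF \<xi> x]
      by (auto simp: c left_jumps_def swap_def numeral_2_eq_2 numeral_3_eq_3)
  qed
  also have "\<dots> = - (\<Sum>\<xi>\<in>\<E>. \<Sum>x\<in>right_jumps N \<xi>. p * w \<xi> * (f (swap \<xi> x) - f \<xi>))"
    unfolding R sum_negf[symmetric] by (simp add: case_prod_unfold)
  finally have "(\<Sum>\<xi>\<in>\<E>. (\<Sum>x\<in>right_jumps N \<xi>. p * w \<xi> * (f (swap \<xi> x) - f \<xi>))
      + (\<Sum>x\<in>left_jumps N \<xi>. q * w \<xi> * (f (swap \<xi> (x - 1)) - f \<xi>))) = 0"
    by (simp add: sum.distrib)
  moreover have "w \<xi> * L f \<xi> = (\<Sum>x\<in>right_jumps N \<xi>. p * w \<xi> * (f (swap \<xi> x) - f \<xi>))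
      + (\<Sum>x\<in>left_jumps N \<xi>. q * w \<xi> * (f (swap \<xi> (x - 1)) - f \<xi>))" if "\<xi> \<in> \<E>" for \<xi>
    unfolding generator_jumps[OF ergodic_config[OF that]] distrib_left sum_distrib_left
    by (simp add: mult_ac)
  ultimately show ?thesis by (simp add: w_def)
qed

abbreviation "\<mu> \<equiv> fep_equilibrium p q N k"

lemma sum_equilibrium:
  "(\<Sum>\<xi>\<in>\<Omega>. \<mu> \<xi> * f \<xi>) = (\<Sum>\<xi>\<in>\<E>. lam ^ hole_area N \<xi> * f \<xi>) / (\<Sum>\<xi>\<in>\<E>. lam ^ hole_area N \<xi>)"
proof -
  have "(\<Sum>\<xi>\<in>\<Omega>. \<mu> \<xi> * f \<xi>) = (\<Sum>\<xi>\<in>\<E>. \<mu> \<xi> * f \<xi>)"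
    by (rule sum.mono_neutral_right) (auto simp: finite_fep_configs ergodic_config fep_equilibrium_def)
  then show ?thesis
    by (simp add: fep_equilibrium_def lam_def sum_divide_distrib)
qed

lemma equilibrium_stationary: "(\<Sum>\<xi>\<in>\<Omega>. \<mu> \<xi> * K f \<xi>) = (\<Sum>\<xi>\<in>\<Omega>. \<mu> \<xi> * f \<xi>)"
proof -
  have "(\<Sum>\<xi>\<in>\<E>. lam ^ hole_area N \<xi> * K f \<xi>)
     = (\<Sum>\<xi>\<in>\<E>. lam ^ hole_area N \<xi> * f \<xi>) + (\<Sum>\<xi>\<in>\<E>. lam ^ hole_area N \<xi> * L f \<xi>) / (2 * real N)"
    by (simp add: K_def distrib_left sum.distrib sum_divide_distrib)
  then show ?thesis by (simp add: sum_equilibrium weight_invariant)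
qed

lemma equilibrium_nonneg: "0 \<le> \<mu> \<xi>"
  unfolding fep_equilibrium_def lam_def[symmetric] using basic
  by (auto intro!: divide_nonneg_nonneg sum_nonneg)

lemma equilibrium_total:
  assumes "\<E> \<noteq> {}" shows "(\<Sum>\<xi>\<in>\<Omega>. \<mu> \<xi>) = 1"
proof -
  have "0 < (\<Sum>\<xi>\<in>\<E>. lam ^ hole_area N \<xi>)"
    using assms erg.finite_S basic by (intro sum_pos) auto
  then show ?thesis using sum_equilibrium[of "\<lambda>_. 1"] by simp
qed

section \<open>Distance from equilibrium\<close>

lemma law_sums:
  fixes t :: real
  assumes \<xi>: "\<xi> \<in> \<Omega>" and B: "finite B"
  defines "s \<equiv> 2 * real N * t"
  shows "(\<lambda>n. exp (- s) * (s ^ n / fact n) * (K ^^ n) (indicator B) \<xi>) sums (\<Sum>\<eta>\<in>B. fep_law p q N t \<xi> \<eta>)"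
proof -
  have L: "L f \<eta> = (2 * real N) * (K f \<eta> - f \<eta>)" for f \<eta> using basic by (simp add: K_def)
  have "(\<lambda>n. exp (- s) * (s ^ n / fact n) * (K ^^ n) (indicator {\<eta>}) \<xi>) sums fep_law p q N t \<xi> \<eta>" for \<eta>
    unfolding fep_law_def s_def by (rule chain.uniformization[OF L \<xi>])
  then have "(\<lambda>n. \<Sum>\<eta>\<in>B. exp (- s) * (s ^ n / fact n) * (K ^^ n) (indicator {\<eta>}) \<xi>)
      sums (\<Sum>\<eta>\<in>B. fep_law p q N t \<xi> \<eta>)" by (intro sums_sum)
  moreover have "(\<Sum>\<eta>\<in>B. exp (- s) * (s ^ n / fact n) * (K ^^ n) (indicator {\<eta>}) \<xi>)
      = exp (- s) * (s ^ n / fact n) * (K ^^ n) (indicator B) \<xi>" for n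
  proof -
    have "(\<lambda>\<zeta>. \<Sum>\<eta>\<in>B. indicator {\<eta>} \<zeta>) = (indicator B :: config \<Rightarrow> real)"
    proof
      fix \<zeta>
      have "(\<Sum>\<eta>\<in>B. indicator {\<eta>} \<zeta>) = (\<Sum>\<eta>\<in>B. if \<zeta> = \<eta> then 1 else (0::real))"
        by (intro sum.cong) auto
      also have "\<dots> = indicator B \<zeta>" using B by (simp add: indicator_def)
      finally show "(\<Sum>\<eta>\<in>B. indicator {\<eta>} \<zeta>) = (indicator B \<zeta> :: real)" .
    qed
    then show ?thesis
      using chain.sum_power[OF \<xi> B, of n "\<lambda>\<eta>. indicator {\<eta>}"] by (simp add: sum_distrib_left)
  qed
  ultimately show ?thesis by simp
qed

lemma distance_ge:
  assumes "\<xi> \<in> \<Omega>" "B \<subseteq> \<Omega>"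
  shows "\<bar>(\<Sum>\<eta>\<in>B. fep_law p q N t \<xi> \<eta>) - (\<Sum>\<eta>\<in>B. \<mu> \<eta>)\<bar> \<le> fep_distance p q N k t"
proof -
  have "\<bar>(\<Sum>\<eta>\<in>B. fep_law p q N t \<xi> \<eta>) - (\<Sum>\<eta>\<in>B. \<mu> \<eta>)\<bar> \<le> tv_dist \<Omega> (fep_law p q N t \<xi>) \<mu>"
    unfolding tv_dist_def using assms finite_fep_configs by (intro Max_ge) auto
  also have "\<dots> \<le> fep_distance p q N k t"
    unfolding fep_distance_def using assms finite_fep_configs by (intro Max_ge) auto
  finally show ?thesis .
qed

definition right_packed :: config where
  "right_packed = (\<lambda>x\<in>{1..N}. if x \<le> m then 0 else 1)"

lemma right_packed_config: "right_packed \<in> \<Omega>"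
proof -
  have "(\<Sum>x=1..N. right_packed x) = (\<Sum>x=1..N. if x \<in> {m<..N} then 1 else 0)"
    by (intro sum.cong) (auto simp: right_packed_def)
  also have "\<dots> = (\<Sum>x\<in>{1..N} \<inter> {m<..N}. 1)" by (rule sum.inter_restrict[symmetric]) simp
  also have "\<dots> = card ({1..N} \<inter> {m<..N})" by simp
  also have "{1..N} \<inter> {m<..N} = {m<..N}" by auto
  also have "card {m<..N} = k" using hole by (simp add: m_def)
  finally show ?thesis by (auto simp: fep_configs_def right_packed_def)
qed

lemma distance_le:
  assumes "\<And>\<xi> B. \<xi> \<in> \<Omega> \<Longrightarrow> B \<subseteq> \<Omega> \<Longrightarrow>
    \<bar>(\<Sum>\<eta>\<in>B. fep_law p q N t \<xi> \<eta>) - (\<Sum>\<eta>\<in>B. \<mu> \<eta>)\<bar> \<le> d"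
  shows "fep_distance p q N k t \<le> d"
  unfolding fep_distance_def
proof (rule Max.boundedI)
  fix a assume "a \<in> (\<lambda>\<xi>. tv_dist \<Omega> (fep_law p q N t \<xi>) \<mu>) ` \<Omega>"
  then obtain \<xi> where \<xi>: "\<xi> \<in> \<Omega>" and a: "a = tv_dist \<Omega> (fep_law p q N t \<xi>) \<mu>" by blast
  show "a \<le> d"
    unfolding a tv_dist_def
  proof (rule Max.boundedI)
    fix b assume "b \<in> (\<lambda>B. \<bar>(\<Sum>\<eta>\<in>B. fep_law p q N t \<xi> \<eta>) - (\<Sum>\<eta>\<in>B. \<mu> \<eta>)\<bar>) ` Pow \<Omega>"
    then show "b \<le> d" using assms[OF \<xi>] by blast
  qed (use finite_fep_configs in auto)
qed (use finite_fep_configs right_packed_config in blast)+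

text \<open>
  After \<open>n0 = j * (n1 + n2 + n3)\<close> discrete steps the distance is at most \<open>\<epsilon> / 2\<close>. The Poisson mean \<open>s\<close>
  is chosen so large that fewer than \<open>n0\<close> steps occur with probability at most \<open>\<epsilon> / 2\<close>.
\<close>

lemma exists_mixed_time:
  assumes v: "1 < v" "q * v\<^sup>2 \<le> p"
    and n3: "2 * (1 + 1 / (v - 1)) / (v - 1) \<le> real n3"
    and n1: "4 * real N * (trap_cost * (real m + 2)) \<le> real n1" "1 \<le> n1"
    and n2: "2 * (real N)\<^sup>2 * (1 + 2 * ln v) * v\<^sup>2 / (p * (v - 1)\<^sup>2) \<le> real n2"
    and \<epsilon>: "0 < \<epsilon>" "\<epsilon> < 1"
    and j: "4 * (2 * real N / p) ^ n3 * ln (2 / \<epsilon>) \<le> real j"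
  defines "s \<equiv> 2 * real (j * (n1 + (n2 + n3))) + 2 * ln (2 / \<epsilon>)"
  shows "\<E> \<noteq> {}" "fep_distance p q N k (s / (2 * real N)) \<le> \<epsilon>"
proof -
  define n0 where "n0 = j * (n1 + (n2 + n3))"
  define c where "c = (p / (2 * real N)) ^ n3 / 4"
  have c0: "0 < c" using basic by (simp add: c_def)
  have minor: "c \<le> (K ^^ (n1 + (n2 + n3))) (indicator ground) \<xi>" if "\<xi> \<in> \<Omega>" for \<xi>
    unfolding c_def by (rule ground_minorization[OF v n1 n2 n3 that])
  have "ground \<noteq> {}"
  proof
    assume "ground = {}"
    then have "(indicator ground :: config \<Rightarrow> real) = (\<lambda>_. 0)" by auto
    then show False
      using minor[OF right_packed_config] c0 chain.const_power[OF right_packed_config, of _ 0] by simp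
  qed
  then obtain z where z: "ground = {z}" using ground_unique by blast
  then have z\<Omega>: "z \<in> \<Omega>" and "z \<in> \<E>" using ergodic_config by (auto simp: ground_def)
  then show ne: "\<E> \<noteq> {}" by auto
  have ln2: "0 < ln (2 / \<epsilon>)" using \<epsilon> by simp
  have c1: "c \<le> 1"
    using minor[OF right_packed_config]
      chain.bounds_power(2)[of 0 "indicator ground" 1 right_packed "n1 + (n2 + n3)"] right_packed_config
    by (fastforce simp: indicator_def)
  have "(1 - c) ^ j \<le> exp (- c) ^ j"
    using c1 exp_ge_add_one_self[of "- c"] by (intro power_mono) auto
  also have "\<dots> = exp (- (c * j))" by (simp flip: exp_of_nat_mult add: mult.commute)
  also have "\<dots> \<le> exp (- ln (2 / \<epsilon>))"
  proof -
    have "ln (2 / \<epsilon>) = c * (4 * (2 * real N / p) ^ n3 * ln (2 / \<epsilon>))"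
      using basic by (simp add: c_def field_simps power_divide)
    also have "\<dots> \<le> c * j" using c0 j by (intro mult_left_mono) auto
    finally show ?thesis by simp
  qed
  also have "\<dots> = \<epsilon> / 2" using \<epsilon> by (simp add: exp_minus)
  finally have cj: "(1 - c) ^ j \<le> \<epsilon> / 2" .
  have "0 \<le> s" using ln2 by (simp add: s_def)
  \<comment> \<open>Time is counted in units of the uniformisation rate \<open>2 * N\<close>.\<close>
  show "fep_distance p q N k (s / (2 * real N)) \<le> \<epsilon>"
  proof (rule distance_le)
    fix \<xi> B assume \<xi>: "\<xi> \<in> \<Omega>" and B: "B \<subseteq> \<Omega>"
    have fB: "finite B" using B finite_fep_configs finite_subset by blast
    define \<pi> where "\<pi> = (\<Sum>\<eta>\<in>B. \<mu> \<eta>)"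
    have \<pi>: "\<pi> = (\<Sum>\<eta>\<in>\<Omega>. \<mu> \<eta> * indicator B \<eta>)"
      unfolding \<pi>_def using B finite_fep_configs
      by (simp add: indicator_def sum.inter_restrict[symmetric] Int_absorb1 if_distrib cong: if_cong)
    have conv: "\<bar>(K ^^ n) (indicator B) \<xi> - \<pi>\<bar> \<le> (1 - c) ^ i" if "i * (n1 + (n2 + n3)) \<le> n" for i n
      unfolding \<pi>
      by (rule chain.doeblin_convergence[OF z\<Omega> _ _ _ equilibrium_nonneg equilibrium_total[OF ne]
            equilibrium_stationary that \<xi>])
         (use minor z in auto)
    have early: "\<bar>(\<Sum>\<eta>\<in>B. fep_law p q N (s / (2 * real N)) \<xi> \<eta>) - \<pi>\<bar> \<le> \<epsilon> / 2 + 2 ^ n0 * exp (- s / 2)"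
    proof (rule poisson_average_bound)
      show "(\<lambda>n. exp (- s) * (s ^ n / fact n) * (K ^^ n) (indicator B) \<xi>)
        sums (\<Sum>\<eta>\<in>B. fep_law p q N (s / (2 * real N)) \<xi> \<eta>)"
        using law_sums[OF \<xi> fB, of "s / (2 * real N)"] basic by simp
      show "\<bar>(K ^^ n) (indicator B) \<xi> - \<pi>\<bar> \<le> 1" for n using conv[of 0 n] by simp
      show "\<bar>(K ^^ n) (indicator B) \<xi> - \<pi>\<bar> \<le> \<epsilon> / 2" if "n0 \<le> n" for n
        using conv[of j n] that cj by (simp add: n0_def)
      show "0 \<le> s" by fact
      show "0 \<le> \<epsilon> / 2" using \<epsilon> by simp
    qed
    have "2 ^ n0 * exp (- s / 2) \<le> \<epsilon> / 2"
    proof -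
      have "(2::real) ^ n0 \<le> exp 1 ^ n0" using exp_ge_add_one_self[of 1] by (intro power_mono) auto
      also have "\<dots> = exp (real n0)" by (simp flip: exp_of_nat_mult)
      finally have "2 ^ n0 * exp (- s / 2) \<le> exp (real n0) * exp (- s / 2)" by (intro mult_right_mono) auto
      also have s2: "- s / 2 = - real n0 - ln (2 / \<epsilon>)" by (simp add: s_def n0_def field_simps)
      also have "exp (real n0) * exp (- real n0 - ln (2 / \<epsilon>)) = exp (- ln (2 / \<epsilon>))"
        by (simp flip: exp_add)
      also have "\<dots> = \<epsilon> / 2" using \<epsilon> by (simp add: exp_minus)
      finally show ?thesis unfolding s2 .
    qed
    then show "\<bar>(\<Sum>\<eta>\<in>B. fep_law p q N (s / (2 * real N)) \<xi> \<eta>) - (\<Sum>\<eta>\<in>B. \<mu> \<eta>)\<bar> \<le> \<epsilon>"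
      using early unfolding \<pi>_def[symmetric] by linarith
  qed
qed

text \<open>
  The harmonic sum dominates the indicator of the ergodic component, is at most \<open>N * lam ^ m\<close> at the
  right packed configuration, and its mean grows at rate at most \<open>lam ^ m\<close>.
\<close>

lemma distance_lower_bound:
  assumes t: "0 \<le> t" and ne: "\<E> \<noteq> {}"
  shows "1 - lam ^ m * (real N + t) \<le> fep_distance p q N k t"
proof -
  let ?\<xi> = right_packed
  define h where "h = particle_sum N (\<lambda>i. lam ^ i)"
  define s where "s = 2 * real N * t"
  have h0: "h ?\<xi> \<le> real N * lam ^ m"
  proof -
    have P: "holes_before ?\<xi> x = m" if "x \<in> {x \<in> {1..N}. ?\<xi> x = 1}" for x
    proof -
      have "m < x" using that by (auto simp: right_packed_def split: if_splits)
      then have "{y \<in> {1..<x}. ?\<xi> y = 0} = {1..m}" using that by (auto simp: right_packed_def)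
      then show ?thesis by (simp add: holes_before_def)
    qed
    then have "h ?\<xi> = real (card {x \<in> {1..N}. ?\<xi> x = 1}) * lam ^ m"
      by (simp add: h_def particle_sum_def)
    also have "\<dots> \<le> real N * lam ^ m"
    proof (rule mult_right_mono)
      have "card {x \<in> {1..N}. ?\<xi> x = 1} \<le> card {1..N}" by (intro card_mono) auto
      then show "real (card {x \<in> {1..N}. ?\<xi> x = 1}) \<le> real N" by simp
    qed (use basic in auto)
    finally show ?thesis .
  qed
  have hE: "indicator \<E> \<xi> \<le> h \<xi>" for \<xi>
  proof (cases "\<xi> \<in> \<E>")
    case True
    then have "1 \<in> {x \<in> {1..N}. \<xi> x = 1}" using ergodic_ends(1) basic by auto
    then have "lam ^ holes_before \<xi> 1 \<le> h \<xi>"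
      unfolding h_def particle_sum_def using basic by (intro member_le_sum) auto
    then show ?thesis using True by simp
  next
    case False
    then show ?thesis using basic by (auto simp: h_def particle_sum_def intro!: sum_nonneg)
  qed
  define r where "r = (p - q) * lam ^ m / (2 * real N)"
  have "(K ^^ n) (indicator \<E>) ?\<xi> \<le> real N * lam ^ m + real n * r" for n
  proof -
    have "(K ^^ n) (indicator \<E>) ?\<xi> \<le> (K ^^ n) h ?\<xi>"
      by (rule chain.mono_power[OF hE right_packed_config])
    also have "\<dots> \<le> h ?\<xi> + real n * r"
      unfolding r_def h_def K_def
      by (rule chain.linear_growth_bound[unfolded K_def, OF _ right_packed_config])
         (use generator_harmonic_sum in \<open>auto intro!: divide_right_mono\<close>)
    finally show ?thesis using h0 by linarith
  qed
  then have le: "exp (- s) * (s ^ n / fact n) * (K ^^ n) (indicator \<E>) ?\<xi>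
      \<le> exp (- s) * (s ^ n / fact n) * (real N * lam ^ m) + exp (- s) * (s ^ n / fact n) * real n * r" for n
    using mult_left_mono[of "(K ^^ n) (indicator \<E>) ?\<xi>" "real N * lam ^ m + real n * r" "exp (- s) * (s ^ n / fact n)"] t
    by (simp add: s_def distrib_left mult.assoc)
  have "(\<Sum>\<eta>\<in>\<E>. fep_law p q N t ?\<xi> \<eta>) \<le> 1 * (real N * lam ^ m) + s * r"
    by (rule sums_le[OF le law_sums[OF right_packed_config erg.finite_S, of t, folded s_def]])
       (intro sums_add sums_mult2 poisson_sums poisson_mean_sums)
  also have "s * r = t * (p - q) * lam ^ m" using basic by (simp add: s_def r_def)
  also have "\<dots> \<le> t * 1 * lam ^ m" using basic t p_lt by (intro mult_right_mono mult_left_mono) auto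
  finally have "(\<Sum>\<eta>\<in>\<E>. fep_law p q N t ?\<xi> \<eta>) \<le> lam ^ m * (real N + t)" by (simp add: algebra_simps)
  moreover have "(\<Sum>\<eta>\<in>\<E>. \<mu> \<eta>) = 1"
  proof -
    have "(\<Sum>\<eta>\<in>\<Omega>. \<mu> \<eta>) = (\<Sum>\<eta>\<in>\<E>. \<mu> \<eta>)"
      by (rule sum.mono_neutral_right) (auto simp: finite_fep_configs ergodic_config fep_equilibrium_def)
    then show ?thesis using equilibrium_total[OF ne] by simp
  qed
  moreover have "\<E> \<subseteq> \<Omega>" using ergodic_config by auto
  ultimately show ?thesis using distance_ge[OF right_packed_config, of \<E> t] by linarith
qed

end

text \<open>
  The exponential factor enters only through the time to become ergodic. All other
  quantities, including the inverse of the probability of reaching the ground state, are polynomial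
  in \<open>N\<close> because \<open>v\<close>, and with it the number \<open>n3\<close> of final steps, depends on \<open>p\<close> and \<open>q\<close> only.
\<close>

lemma mixed_time_bound:
  assumes pq: "1/2 < p" "p < 1" "q = 1 - p" and \<epsilon>: "0 < \<epsilon>" "\<epsilon> < 1"
  shows "\<exists>C a. 0 < C \<and> (\<forall>N k. fep p q N k \<longrightarrow> fep_ergodic N k \<noteq> {} \<and>
       (\<exists>t\<ge>0. t \<le> C * real N ^ a * (p / q) ^ (N - k) \<and> fep_distance p q N k t \<le> \<epsilon>))"
proof -
  have q: "0 < q" "q < p" using pq by auto
  obtain v where v: "1 < v" "q * v\<^sup>2 \<le> p"
  proof
    show "1 < sqrt (p / q)" using q by simp
    show "q * (sqrt (p / q))\<^sup>2 \<le> p" using q by simp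
  qed
  obtain n3 where n3: "2 * (1 + 1 / (v - 1)) / (v - 1) \<le> real n3" using real_arch_simple by blast
  define A where "A = 2 / (p - q) + p / (p - q)\<^sup>2"
  define B where "B = 2 * (1 + 2 * ln v) * v\<^sup>2 / (p * (v - 1)\<^sup>2)"
  define D where "D = 4 * (2 / p) ^ n3 * ln (2 / \<epsilon>)"
  have pos: "0 < A" "0 < B" "0 < D" "0 < ln (2 / \<epsilon>)"
    using q v \<epsilon> pq by (auto simp: A_def B_def D_def add_pos_pos)
  define C1 where "C1 = 12 * A + 2 + (B + 1) + real n3"
  define C where "C = 2 * ((D + 1) * C1) + 2 * ln (2 / \<epsilon>)"
  have C1: "0 < C1" using pos by (simp add: C1_def)
  show ?thesis
  proof (rule exI[of _ C], rule exI[of _ "n3 + 4"], intro conjI allI impI)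
    show "0 < C" unfolding C_def using pos C1 by (intro add_pos_pos mult_pos_pos) auto
    fix N k assume "fep p q N k"
    then interpret fep p q N k .
    define U where "U = (p / q) ^ m"
    have U: "1 \<le> U" "walk_const = U * (p / (p - q)\<^sup>2)"
    proof -
      show "1 \<le> U" unfolding U_def using q by (intro one_le_power) simp
      show "walk_const = U * (p / (p - q)\<^sup>2)"
        using q by (simp add: U_def walk_const_def lam_def power_divide mult.commute)
    qed
    have N1: "1 \<le> real N" using basic by simp
    \<comment> \<open>The common scale of the lengths of the three phases.\<close>
    define Y where "Y = real N ^ 4 * U"
    have N4: "1 \<le> real N ^ 4" using N1 by simp
    have Y: "1 \<le> Y" "real N ^ 2 \<le> Y"
    proof -
      show "1 \<le> Y" unfolding Y_def using mult_mono[OF N4 U(1)] by simp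
      have "real N ^ 2 \<le> real N ^ 4" using N1 by (intro power_increasing) auto
      also have "\<dots> \<le> Y" using mult_left_mono[OF U(1), of "real N ^ 4"] by (simp add: Y_def)
      finally show "real N ^ 2 \<le> Y" .
    qed
    define n1 n2 j where "n1 = nat \<lceil>4 * real N * (trap_cost * (real m + 2))\<rceil> + 1"
      and "n2 = nat \<lceil>B * (real N)\<^sup>2\<rceil>" and "j = nat \<lceil>D * real N ^ n3\<rceil>"
    have tc: "trap_cost \<le> real N * (real N * U * A)"
    proof -
      have "2 * real m / (p - q) \<le> real N * U * (2 / (p - q))"
      proof -
        have "real m \<le> real N * U" using basic(9) U(1) mult_mono[of "real m" "real N" 1 U] by simp
        then have "real m * (2 / (p - q)) \<le> real N * U * (2 / (p - q))"
          using q by (intro mult_right_mono) auto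
        then show ?thesis by (simp add: mult.commute)
      qed
      moreover have "walk_const \<le> real N * U * (p / (p - q)\<^sup>2)"
        unfolding U(2) using q N1 U by (intro mult_right_mono) auto
      ultimately have "2 * real m / (p - q) + walk_const \<le> real N * U * A"
        by (simp add: A_def distrib_left)
      then show ?thesis unfolding trap_cost_def by (intro mult_left_mono) auto
    qed
    have "4 * real N * (trap_cost * (real m + 2)) \<le> 4 * real N * (real N * (real N * U * A) * (3 * real N))"
    proof (intro mult_left_mono mult_mono tc)
      show "real m + 2 \<le> 3 * real N" using basic by linarith
    qed (use trap_cost_nonneg basic U pos in auto)
    also have "\<dots> = 12 * A * Y" by (simp add: Y_def power4_eq_xxxx)
    finally have b1: "4 * real N * (trap_cost * (real m + 2)) \<le> 12 * A * Y" .
    have t0: "0 \<le> 4 * real N * (trap_cost * (real m + 2))" using trap_cost_nonneg by simp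
    have "real n1 \<le> 12 * A * Y + 2" unfolding n1_def using b1 t0 by linarith
    also have "\<dots> \<le> (12 * A + 2) * Y" using Y(1) by (simp add: distrib_right)
    finally have r1: "real n1 \<le> (12 * A + 2) * Y" .
    have "real n2 \<le> B * (real N)\<^sup>2 + 1" unfolding n2_def using pos by (simp add: of_nat_ceiling)
    also have "\<dots> \<le> B * Y + 1 * Y" using Y pos by (intro add_mono mult_left_mono) auto
    finally have r2: "real n2 \<le> (B + 1) * Y" by (simp add: distrib_right)
    have r3: "real n3 \<le> real n3 * Y" using Y(1) mult_left_mono[of 1 Y "real n3"] by simp
    have Mt: "real (n1 + (n2 + n3)) \<le> C1 * Y" using r1 r2 r3 by (simp add: C1_def distrib_right)
    have n31: "1 \<le> real N ^ n3" using N1 by (rule one_le_power)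
    have "real j \<le> D * real N ^ n3 + 1" unfolding j_def using pos by (simp add: of_nat_ceiling)
    also have "\<dots> \<le> (D + 1) * real N ^ n3" using n31 by (simp add: distrib_right)
    finally have rj: "real j \<le> (D + 1) * real N ^ n3" .
    define s where "s = 2 * real (j * (n1 + (n2 + n3))) + 2 * ln (2 / \<epsilon>)"
    note mixed = exists_mixed_time[OF v n3, of n1 n2 \<epsilon> j, folded s_def]
    have args: "4 * real N * (trap_cost * (real m + 2)) \<le> real n1" "1 \<le> n1"
      "2 * (real N)\<^sup>2 * (1 + 2 * ln v) * v\<^sup>2 / (p * (v - 1)\<^sup>2) \<le> real n2"
      "4 * (2 * real N / p) ^ n3 * ln (2 / \<epsilon>) \<le> real j"
    proof -
      show "4 * real N * (trap_cost * (real m + 2)) \<le> real n1" "1 \<le> n1"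
        unfolding n1_def by linarith+
      have "2 * (real N)\<^sup>2 * (1 + 2 * ln v) * v\<^sup>2 / (p * (v - 1)\<^sup>2) = B * (real N)\<^sup>2"
        by (simp add: B_def)
      also have "\<dots> \<le> real n2" unfolding n2_def by linarith
      finally show "2 * (real N)\<^sup>2 * (1 + 2 * ln v) * v\<^sup>2 / (p * (v - 1)\<^sup>2) \<le> real n2" .
      have "4 * (2 * real N / p) ^ n3 * ln (2 / \<epsilon>) = D * real N ^ n3"
        by (simp add: D_def power_divide power_mult_distrib)
      also have "\<dots> \<le> real j" unfolding j_def by linarith
      finally show "4 * (2 * real N / p) ^ n3 * ln (2 / \<epsilon>) \<le> real j" .
    qed
    have "real (j * (n1 + (n2 + n3))) \<le> ((D + 1) * real N ^ n3) * (C1 * Y)"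
      unfolding of_nat_mult using rj Mt pos by (intro mult_mono) auto
    also have "\<dots> = (D + 1) * C1 * (real N ^ (n3 + 4) * U)" by (simp add: Y_def power_add)
    finally have jn: "real (j * (n1 + (n2 + n3))) \<le> (D + 1) * C1 * (real N ^ (n3 + 4) * U)" .
    have W: "1 \<le> real N ^ (n3 + 4) * U"
      using mult_mono[OF one_le_power[OF N1, of "n3 + 4"] U(1)] by simp
    have "s \<le> 2 * ((D + 1) * C1 * (real N ^ (n3 + 4) * U)) + 2 * ln (2 / \<epsilon>) * (real N ^ (n3 + 4) * U)"
      unfolding s_def using jn W pos(4) mult_left_mono[OF W, of "2 * ln (2 / \<epsilon>)"] by linarith
    also have "\<dots> = C * real N ^ (n3 + 4) * (p / q) ^ (N - k)"
      by (simp add: C_def U_def m_def algebra_simps)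
    finally have sC: "s \<le> C * real N ^ (n3 + 4) * (p / q) ^ (N - k)" .
    have s0: "0 \<le> s" using pos by (simp add: s_def)
    have "s / (2 * real N) \<le> s / 1" using s0 N1 by (intro divide_left_mono) auto
    then have "s / (2 * real N) \<le> C * real N ^ (n3 + 4) * (p / q) ^ (N - k)" using sC by simp
    then show "\<exists>t\<ge>0. t \<le> C * real N ^ (n3 + 4) * (p / q) ^ (N - k) \<and> fep_distance p q N k t \<le> \<epsilon>"
      using mixed(2)[OF args(1-3) \<epsilon> args(4)] s0 by (intro exI[of _ "s / (2 * real N)"]) auto
    show "fep_ergodic N k \<noteq> {}" by (rule mixed(1)[OF args(1-3) \<epsilon> args(4)])
  qed
qed

section \<open>The exponential growth rate of the mixing time\<close>

theorem theorem2p2: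
  fixes p q \<epsilon> :: real and k :: "nat \<Rightarrow> nat"
  assumes "1/2 < p" and "p < 1" and "q = 1 - p"
    and "0 < \<epsilon>" and "\<epsilon> < 1"
    and "\<And>N. N \<ge> 1 \<Longrightarrow> real N / 2 < real (k N) \<and> k N \<le> N"
    and "(\<lambda>N. ln (real N)) \<in> o(\<lambda>N. real N - real (k N))"
  shows "(\<lambda>N. ln (fep_mixing_time p q N (k N) \<epsilon>) / (real N - real (k N)))
           \<longlonglongrightarrow> ln (p / q)"
proof -
  define u where "u = p / q"
  define m where "m N = real N - real (k N)" for N
  define T where "T N = fep_mixing_time p q N (k N) \<epsilon>" for N
  have q: "0 < q" "q < p" using assms by auto
  have u: "1 < u" using q by (simp add: u_def)
  obtain C a where C: "0 < C" and mixed: "\<And>N k. fep p q N k \<Longrightarrow> fep_ergodic N k \<noteq> {} \<and>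
       (\<exists>t\<ge>0. t \<le> C * real N ^ a * (p / q) ^ (N - k) \<and> fep_distance p q N k t \<le> \<epsilon>)"
    using mixed_time_bound[OF assms(1-5)] by blast
  have ln_m: "(\<lambda>N. ln (real N) / m N) \<longlonglongrightarrow> 0"
    using smalloD_tendsto[OF assms(7)] by (simp add: m_def)
  have m_pos: "\<forall>\<^sub>F N in sequentially. 0 < m N"
  proof -
    have "\<forall>\<^sub>F N in sequentially. norm (ln (real N)) \<le> 1 * norm (m N)"
      using landau_o.smallD[OF assms(7), of 1] by (simp add: m_def)
    then show ?thesis using eventually_ge_at_top[of 2]
    proof eventually_elim
      case (elim N)
      have "0 < ln (real N)" using elim by simp
      moreover have "0 \<le> m N" using assms(6)[of N] elim by (simp add: m_def)
      moreover have "\<bar>ln (real N)\<bar> \<le> \<bar>m N\<bar>" using elim(1) by simp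
      ultimately show ?case by linarith
    qed
  qed
  have inv_m: "(\<lambda>N. c / m N) \<longlonglongrightarrow> 0" for c
  proof -
    have "(\<lambda>N. 1 / m N) \<longlonglongrightarrow> 0"
    proof (rule tendsto_sandwich[OF _ _ tendsto_const ln_m])
      show "\<forall>\<^sub>F N in sequentially. 0 \<le> 1 / m N" using m_pos by eventually_elim simp
      show "\<forall>\<^sub>F N in sequentially. 1 / m N \<le> ln (real N) / m N"
        using m_pos eventually_ge_at_top[of 3]
      proof eventually_elim
        case (elim N)
        have "exp 1 \<le> real N" using exp_le elim by linarith
        then have "1 \<le> ln (real N)" using elim by (simp add: ln_ge_iff)
        then show ?case using elim by (intro divide_right_mono) auto
      qed
    qed
    from tendsto_mult_left[OF this, of c] show ?thesis by simp
  qed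
  have bounds: "\<forall>\<^sub>F N in sequentially. (1 - \<epsilon>) * u powr m N - real N \<le> T N \<and> T N \<le> C * real N ^ a * u powr m N"
    using m_pos eventually_ge_at_top[of 1]
  proof eventually_elim
    case (elim N)
    have k: "real N / 2 < real (k N)" "k N \<le> N" using assms(6)[of N] elim by auto
    have kN: "k N < N" using elim(1) by (simp add: m_def)
    interpret F: fep p q N "k N"
      by standard (use assms(1-3) k kN in auto)
    have um: "u powr m N = (p / q) ^ (N - k N)"
      using u k by (simp add: m_def u_def powr_realpow[symmetric] of_nat_diff)
    define S where "S = {t. t \<ge> 0 \<and> fep_distance p q N (k N) t \<le> \<epsilon>}"
    have ne: "fep_ergodic N (k N) \<noteq> {}" using mixed[OF F.fep_axioms] by simp
    obtain t where t: "0 \<le> t" "t \<le> C * real N ^ a * (p / q) ^ (N - k N)" "t \<in> S"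
      using mixed[OF F.fep_axioms] by (auto simp: S_def)
    have T: "T N = Inf S" by (simp add: T_def fep_mixing_time_def S_def)
    have "T N \<le> t" unfolding T using t by (intro cInf_lower bdd_belowI[of _ 0]) (auto simp: S_def)
    moreover have "(1 - \<epsilon>) * u powr m N - real N \<le> T N" unfolding T
    proof (rule cInf_greatest)
      show "S \<noteq> {}" using t by auto
      fix t assume "t \<in> S"
      then have "1 - F.lam ^ F.m * (real N + t) \<le> \<epsilon>"
        using F.distance_lower_bound[OF _ ne, of t] by (auto simp: S_def)
      then have "(1 - \<epsilon>) * (p / q) ^ F.m \<le> F.lam ^ F.m * (real N + t) * (p / q) ^ F.m"
        using q by (intro mult_right_mono) auto
      also have "F.lam ^ F.m * (real N + t) * (p / q) ^ F.m = (F.lam * (p / q)) ^ F.m * (real N + t)"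
        by (simp only: power_mult_distrib mult_ac)
      also have "\<dots> = real N + t" using q by (simp add: F.lam_def)
      finally show "(1 - \<epsilon>) * u powr m N - real N \<le> t" by (simp add: um F.m_def)
    qed
    ultimately show ?case using t by (simp add: um)
  qed
  have "(\<lambda>N. ln (real N) / m N + ln (2 / (1 - \<epsilon>)) / m N) \<longlonglongrightarrow> 0 + 0"
    by (intro tendsto_add ln_m inv_m)
  then have small: "\<forall>\<^sub>F N in sequentially. ln (real N) / m N + ln (2 / (1 - \<epsilon>)) / m N < ln u"
    using u by (intro order_tendstoD(2)) auto
  have both: "\<forall>\<^sub>F N in sequentially. ln u - ln (2 / (1 - \<epsilon>)) / m N \<le> ln (T N) / m N
      \<and> ln (T N) / m N \<le> ln u + (ln C / m N + real a * (ln (real N) / m N))"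
    using bounds m_pos small eventually_ge_at_top[of 1]
  proof eventually_elim
    case (elim N)
    have lnum: "ln (u powr m N) = m N * ln u" using u by (simp add: ln_powr)
    have e: "0 < 1 - \<epsilon>" using assms by simp
    have "ln (real N) + ln (2 / (1 - \<epsilon>)) < m N * ln u"
      using elim(2,3) by (simp add: field_simps)
    then have "ln (real N * (2 / (1 - \<epsilon>))) < ln (u powr m N)"
      unfolding lnum using elim(4) e by (subst ln_mult) auto
    then have "real N * (2 / (1 - \<epsilon>)) < u powr m N"
      using elim(4) e u by (subst (asm) ln_less_cancel_iff) auto
    then have "real N < (1 - \<epsilon>) / 2 * u powr m N" using e by (simp add: field_simps)
    moreover have "(1 - \<epsilon>) * u powr m N - real N \<le> T N" using elim(1) by simp
    ultimately have lo: "(1 - \<epsilon>) / 2 * u powr m N \<le> T N" by (simp add: field_simps)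
    have X: "0 < (1 - \<epsilon>) / 2 * u powr m N" using e u by simp
    have "ln ((1 - \<epsilon>) / 2 * u powr m N) \<le> ln (T N)" using X lo by (intro ln_mono) auto
    moreover have "ln ((1 - \<epsilon>) / 2 * u powr m N) = m N * ln u - ln (2 / (1 - \<epsilon>))"
      using e u by (subst ln_mult) (auto simp: lnum ln_div)
    ultimately have l1: "m N * ln u - ln (2 / (1 - \<epsilon>)) \<le> ln (T N)" by simp
    have "ln (T N) \<le> ln (C * real N ^ a * u powr m N)"
      using elim(1) X lo by (intro ln_mono) auto
    also have "\<dots> = ln C + real a * ln (real N) + m N * ln u"
      using C elim(4) u by (simp add: ln_mult ln_realpow lnum)
    finally have l2: "ln (T N) \<le> ln C + real a * ln (real N) + m N * ln u" .
    have "(m N * ln u - ln (2 / (1 - \<epsilon>))) / m N \<le> ln (T N) / m N"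
      using l1 elim(2) by (intro divide_right_mono) auto
    moreover have "ln (T N) / m N \<le> (ln C + real a * ln (real N) + m N * ln u) / m N"
      using l2 elim(2) by (intro divide_right_mono) auto
    ultimately show ?case using elim(2) by (simp add: add_divide_distrib diff_divide_distrib)
  qed
  have "(\<lambda>N. ln (T N) / m N) \<longlonglongrightarrow> ln u"
  proof (rule tendsto_sandwich)
    show "(\<lambda>N. ln u - ln (2 / (1 - \<epsilon>)) / m N) \<longlonglongrightarrow> ln u"
      using tendsto_diff[OF tendsto_const[of "ln u"] inv_m[of "ln (2 / (1 - \<epsilon>))"]] by simp
    show "(\<lambda>N. ln u + (ln C / m N + real a * (ln (real N) / m N))) \<longlonglongrightarrow> ln u"
      using tendsto_add[OF tendsto_const[of "ln u"] tendsto_add[OF inv_m[of "ln C"] tendsto_mult_left[OF ln_m, of "real a"]]]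
      by simp
  qed (use both in \<open>auto elim: eventually_mono\<close>)
  then show ?thesis by (simp add: T_def m_def u_def)
qed

end
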